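(* Suppose $M=+\infty$ and the function $\phi$ satisfies $$\lim_{x\to\infty}\frac{x\phi(x)}{\int_x^\infty\phi(u)\,du}=p,\qquad p>0$$ (with $\int_x^\infty\phi(u)\,du<\infty$). Then $\mu(t)$ is regularly varying with exponent $\frac{1}{p+2}$, and, in particular, $$\lim_{t\to\infty}\frac{\mu(t)}{t^c}=\begin{cases}+\infty & c<\frac{1}{p+2}\\ 0 & c>\frac{1}{p+2}.\end{cases}$$ Moreover, provided $E[X_0^2]<\infty$, $\mathrm{Var}[S_t]$, as a function of $t$, is regularly varying with exponent $\frac{2}{p+2}$. In particular, $$\lim_{t\to\infty}\frac{\mathrm{Var}[S_t]}{t^c}=\begin{cases}+\infty & c<\frac{2}{p+2}\\ 0 & c>\frac{2}{p+2}.\end{cases}$$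
   Context: Data: $\lambda>0$; $F,F_0$ are cumulative distribution functions (CDFs) on $\mathbb{R}$ (offer distribution and residual price distribution); $X\sim F$, $X_0\sim F_0$; $y_+=\max(y,0)$; $\mu_0=E[X_0]$; $M=\sup\{x : F(x)<1\}\in(-\infty,+\infty]$. Standing assumptions: $E[X_+]<\infty$, $E[|X_0|]<\infty$, $0\le\mu_0<M$. A measurable function $R:[0,\infty)\to[0,\infty)$ is regularly varying with exponent $\rho$ if $\lim_{s\to\infty}\frac{R(xs)}{R(s)}=x^\rho$ for all $x>0$. Define $\phi(x)=\int_x^\infty[1-F(u)]\,du$ and $\Psi(x)=\int_{\mu_0}^x\frac{du}{\phi(u)}$ for $x\in[\mu_0,M)$. The optimal policy is the function $\mu:[0,\infty)\to[\mu_0,M)$, $\mu(t)=\Psi^{-1}(\lambda t)$; equivalently, the solution of $\mu'(t)=\lambda\phi(\mu(t))$, $\mu(0)=\mu_0$. Bidding process with marketing period $t\ge 0$ under the optimal policy: let $D_1,D_2,\dots$ be exponential with rate $\lambda$ (inter-arrival times of offers), $X_1,X_2,\dots$ be distributed according to $F$ (offer values), and $X_0$ be distributed according to $F_0$, all independent. The time remaining to the deadline when the $i$-th offer arrives is $t_i=\max(t_{i-1}-D_i,0)$, with initial value $t$ (that is, $t_i=(t-D_1-\dots-D_i)_+$). An offer $X_i$ with $t_i>0$ is accepted if and only if $X_i\ge\mu(t_i)$; at the first accepted offer $i$ the process ends, with realized sale price $S_t=X_i$. If no offer is accepted before the remaining time reaches $0$, then $S_t=X_0$. *)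

theory Defs
  imports "HOL-Probability.Probability"
begin

text \<open>The offer distribution \<open>F\<close> and the residual price distribution \<open>F0\<close> are represented by
  probability laws on the real line (\<^locale>\<open>real_distribution\<close>); the corresponding cumulative
  distribution functions are \<open>cdf F\<close> and \<open>cdf F0\<close>.\<close>

text \<open>Only the values of \<open>R\<close> on \<open>[0, \<infinity>)\<close> matter. Although division by zero yields zero, the limit
  below is positive and therefore forces \<open>R s \<noteq> 0\<close> for all large \<open>s\<close>.\<close>

definition regularly_varying :: "(real \<Rightarrow> real) \<Rightarrow> real \<Rightarrow> bool" where
  "regularly_varying R \<rho> \<longleftrightarrow>
     R \<in> borel_measurable (restrict_space borel {0..}) \<and>
     (\<forall>t\<ge>0. 0 \<le> R t) \<and>
     (\<forall>x>0. ((\<lambda>s. R (x * s) / R s) \<longlongrightarrow> x powr \<rho>) at_top)"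

definition residual_mean :: "real measure \<Rightarrow> real" where
  "residual_mean F0 = (\<integral>x. x \<partial>F0)"

definition upper_end :: "real measure \<Rightarrow> ereal" where
  "upper_end F = (SUP x\<in>{x. cdf F x < 1}. ereal x)"

definition phi :: "real measure \<Rightarrow> real \<Rightarrow> real" where
  "phi F x = (LBINT u:{x..}. 1 - cdf F u)"

definition Psi :: "real measure \<Rightarrow> real measure \<Rightarrow> real \<Rightarrow> real" where
  "Psi F F0 x = (LBINT u:{residual_mean F0..x}. 1 / phi F u)"

definition optimal_policy :: "real \<Rightarrow> real measure \<Rightarrow> real measure \<Rightarrow> real \<Rightarrow> real" where
  "optimal_policy lam F F0 t =
     inv_into {x. residual_mean F0 \<le> x \<and> ereal x < upper_end F} (Psi F F0) (lam * t)"

text \<open>In the sequences below, \<open>D i\<close> and \<open>X i\<close> with \<open>i \<ge> 1\<close> are the inter-arrival times and the offer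
  values, while \<open>X 0\<close> is the residual price; \<open>D 0\<close> is not used.\<close>

primrec remaining_time :: "(nat \<Rightarrow> 'a \<Rightarrow> real) \<Rightarrow> real \<Rightarrow> 'a \<Rightarrow> nat \<Rightarrow> real" where
  "remaining_time D t \<omega> 0 = t"
| "remaining_time D t \<omega> (Suc i) = max (remaining_time D t \<omega> i - D (Suc i) \<omega>) 0"

definition accepted ::
  "(real \<Rightarrow> real) \<Rightarrow> (nat \<Rightarrow> 'a \<Rightarrow> real) \<Rightarrow> (nat \<Rightarrow> 'a \<Rightarrow> real) \<Rightarrow> real \<Rightarrow> 'a \<Rightarrow> nat \<Rightarrow> bool" where
  "accepted policy D X t \<omega> i \<longleftrightarrow>
     1 \<le> i \<and> 0 < remaining_time D t \<omega> i \<and> policy (remaining_time D t \<omega> i) \<le> X i \<omega>"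

definition sale_price ::
  "(real \<Rightarrow> real) \<Rightarrow> (nat \<Rightarrow> 'a \<Rightarrow> real) \<Rightarrow> (nat \<Rightarrow> 'a \<Rightarrow> real) \<Rightarrow> real \<Rightarrow> 'a \<Rightarrow> real" where
  "sale_price policy D X t \<omega> =
     (if \<exists>i. accepted policy D X t \<omega> i
      then X (LEAST i. accepted policy D X t \<omega> i) \<omega>
      else X 0 \<omega>)"

definition bidding_model ::
  "real \<Rightarrow> real measure \<Rightarrow> real measure \<Rightarrow> 'a measure \<Rightarrow> (nat \<Rightarrow> 'a \<Rightarrow> real) \<Rightarrow> (nat \<Rightarrow> 'a \<Rightarrow> real) \<Rightarrow> bool"
where
  "bidding_model lam F F0 P D X \<longleftrightarrow>
     prob_space P \<and>
     prob_space.indep_vars P (\<lambda>_. borel) (case_sum D X) ({1..} <+> UNIV) \<and>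
     (\<forall>i\<ge>1. distributed P lborel (D i) (exponential_density lam)) \<and>
     (\<forall>i\<ge>1. distr P borel (X i) = F) \<and>
     distr P borel (X 0) = F0"

end

theory Submission
  imports Defs
begin

text \<open>
  Write \<open>\<Phi>(x)\<close> for the integral of \<open>\<phi>\<close> over \<open>[x, \<infinity>)\<close>, so that \<open>\<phi>(x) = E (X - x)\<^sub>+\<close> and
  \<open>2 \<Phi>(x) = E ((X - x)\<^sub>+)^2\<close>, and write \<open>m0\<close> for the mean residual price.

  A function whose logarithmic derivative \<open>s f'(s) / f(s)\<close> tends to \<open>\<rho>\<close> varies regularly with exponent
  \<open>\<rho>\<close>, and \<open>ln f(s) / ln s\<close> tends to \<open>\<rho>\<close>, which yields the comparison with powers. For the policy,
  \<open>\<mu>' = \<lambda> \<phi>(\<mu>)\<close> and \<open>\<lambda> t = \<Psi>(\<mu>(t))\<close> turn the logarithmic derivative into \<open>\<Psi>(s) \<phi>(s) / s\<close> at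
  \<open>s = \<mu>(t)\<close>. The hypothesis says that \<open>s \<phi>(s) / \<Phi>(s)\<close> tends to \<open>p\<close>, and comparing the derivatives of
  \<open>\<Psi>(s)\<close> and \<open>s^2 / \<Phi>(s)\<close> by l'Hospital's rule gives the limit \<open>1 / (p + 2)\<close>
  (\<open>log_derivative_\<mu>\<close>).

  The variance has a closed form in terms of \<open>s = \<mu>(t)\<close>. Let \<open>v(t)\<close> be the variance; conditioning on the next
  offer gives \<open>v' = \<lambda> (2 \<Phi>(\<mu>) - P(X \<ge> \<mu>) v)\<close>. In the variable \<open>s\<close>, and because \<open>\<phi>'\<close> is minus the
  survival function, this reads \<open>(v / \<phi>)' = 2 \<Phi> / \<phi>^2\<close>. Hence \<open>v(t) = \<phi>(s) scaled_variance(s)\<close>, where \<open>scaled_variance\<close> is the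
  integral of \<open>2 \<Phi> / \<phi>^2\<close> from \<open>m0\<close> with initial value \<open>Var X\<^sub>0 / \<phi>(m0)\<close>. A second use of l'Hospital's
  rule, now against \<open>s^3 / \<Phi>(s)\<close>, shows that \<open>\<phi>(s) scaled_variance(s) / s^2\<close> tends to \<open>2 / (p (p + 3))\<close>
  (\<open>variance_over_square_tendsto\<close>). The limit is positive, so the variance inherits from \<open>\<mu>^2\<close> all that is
  claimed.

  It remains to justify the formula for the variance of the actual process. A pair of a payoff \<open>h\<close> and a
  function \<open>W\<close> is called fair if a seller who receives \<open>h(X)\<close> when accepting and holds
  \<open>W(\<mu>(r))\<close> when \<open>r\<close> time units remain neither gains nor loses on average with the next offer
  (\<open>one_step\<close>). Then the payoff collected so far plus the current holding is a martingale up to the sale; since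
  the deadline passes after finitely many offers almost surely, \<open>E h(S\<^sub>t) = W(\<mu>(t))\<close>
  (\<open>expectation_h_sale_price\<close>). Only the independence of the next offer from the past enters; no restart of the
  process with shifted offers has to be constructed. The pairs \<open>h(x) = x\<close>, \<open>W(u) = u\<close> and
  \<open>h(x) = x^2\<close>, \<open>W(u) = u^2 + \<phi>(u) scaled_variance(u)\<close> give the first two moments. Since \<open>F\<close> may have atoms, the second
  \<open>W\<close> need not be differentiable; fairness is therefore stated as an integral identity in the price variable,
  and \<open>survival_by_parts\<close> supplies the integration by parts that replaces \<open>\<phi>' = - P(X \<ge> u)\<close>.
\<close>

section \<open>Functions with a convergent logarithmic derivative\<close>

text \<open>In logarithmic coordinates the hypothesis says that \<open>ln f(exp t) - \<rho> t\<close> has a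
  derivative tending to zero, so its increments over steps of the fixed length \<open>ln x\<close> tend to
  zero. This avoids the representation and uniform convergence theorems for regularly varying
  functions.\<close>

lemma ratio_tendsto_powr_if_log_derivative:
  fixes f f' :: "real \<Rightarrow> real"
  assumes pos: "\<forall>\<^sub>F s in at_top. 0 < f s"
    and der: "\<forall>\<^sub>F s in at_top. (f has_real_derivative f' s) (at s)"
    and lim: "((\<lambda>s. s * f' s / f s) \<longlongrightarrow> \<rho>) at_top"
    and x: "0 < x"
  shows "((\<lambda>s. f (x * s) / f s) \<longlongrightarrow> x powr \<rho>) at_top"
proof -
  define g where "g t = ln (f (exp t)) - \<rho> * t" for t
  have "((\<lambda>t. g (t + ln x) - g t) \<longlongrightarrow> 0) at_top"
  proof (rule tendstoI)
    fix e :: real assume e: "0 < e"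
    \<comment> \<open>Adding one covers \<open>x = 1\<close> and makes \<open>d * \<bar>ln x\<bar>\<close> strictly smaller than \<open>e\<close>.\<close>
    define d where "d = e / (1 + \<bar>ln x\<bar>)"
    have d: "0 < d" using e by (simp add: d_def add_pos_nonneg)
    have "\<forall>\<^sub>F s in at_top. 0 < f s \<and> (f has_real_derivative f' s) (at s) \<and> dist (s * f' s / f s) \<rho> < d"
      using pos der tendstoD[OF lim d] by eventually_elim auto
    then obtain N where N: "\<And>s. N \<le> s \<Longrightarrow> 0 < f s"
      "\<And>s. N \<le> s \<Longrightarrow> (f has_real_derivative f' s) (at s)"
      "\<And>s. N \<le> s \<Longrightarrow> \<bar>s * f' s / f s - \<rho>\<bar> < d"
      unfolding eventually_at_top_linorder dist_real_def by auto
    obtain T where T: "\<And>t. T \<le> t \<Longrightarrow> N \<le> exp t"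
      using filterlim_at_top[THEN iffD1, OF exp_at_top, rule_format, of N]
      unfolding eventually_at_top_linorder by auto
    have bound: "norm (g u - g v) \<le> d * norm (u - v)" if "T \<le> u" "T \<le> v" for u v
    proof (rule field_differentiable_bound[of "{T..}"])
      fix t assume "t \<in> {T..}"
      then have t: "N \<le> exp t" using T by simp
      have "((\<lambda>t. f (exp t)) has_real_derivative f' (exp t) * exp t) (at t within {T..})"
        using N(2)[OF t] by (intro DERIV_chain'[of exp "exp t" t _ f]) (auto intro!: derivative_eq_intros)
      then show "(g has_real_derivative exp t * f' (exp t) / f (exp t) - \<rho>) (at t within {T..})"
        unfolding g_def using N(1)[OF t]
        by (auto intro!: derivative_eq_intros simp: field_simps)
      show "norm (exp t * f' (exp t) / f (exp t) - \<rho>) \<le> d"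
        using N(3)[OF t] by simp
    qed (use that in auto)
    show "\<forall>\<^sub>F t in at_top. dist (g (t + ln x) - g t) 0 < e"
      using eventually_ge_at_top[of T] eventually_ge_at_top[of "T - ln x"]
    proof eventually_elim
      case (elim t)
      have "d * \<bar>ln x\<bar> < e"
        using e by (simp add: d_def field_simps add_pos_nonneg)
      moreover have "norm (g (t + ln x) - g t) \<le> d * \<bar>ln x\<bar>"
        using bound[of "t + ln x" t] elim by simp
      ultimately show ?case by simp
    qed
  qed
  then have "((\<lambda>s. g (ln s + ln x) - g (ln s)) \<longlongrightarrow> 0) at_top"
    using ln_at_top by (rule filterlim_compose)
  then have "((\<lambda>s. x powr \<rho> * exp (g (ln s + ln x) - g (ln s))) \<longlongrightarrow> x powr \<rho> * exp 0) at_top"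
    by (intro tendsto_intros)
  moreover have "\<forall>\<^sub>F s in at_top. x powr \<rho> * exp (g (ln s + ln x) - g (ln s)) = f (x * s) / f s"
  proof -
    have "filterlim (\<lambda>s. x * s) at_top at_top"
      by (rule filterlim_tendsto_pos_mult_at_top[OF tendsto_const x filterlim_ident])
    then have "\<forall>\<^sub>F s in at_top. 0 < f (x * s)"
      by (rule eventually_compose_filterlim[OF pos])
    then show ?thesis
      using pos eventually_gt_at_top[of 0]
    proof eventually_elim
      case (elim s)
      have "exp (ln s + ln x) = x * s" using x elim by (simp add: exp_add)
      then have "g (ln s + ln x) - g (ln s) = ln (f (x * s) / f s) - \<rho> * ln x"
        unfolding g_def using elim by (simp add: ln_div algebra_simps)
      moreover have "x powr \<rho> = exp (\<rho> * ln x)" using x by (simp add: powr_def)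
      ultimately show ?case using elim by (simp add: exp_diff)
    qed
  qed
  ultimately show ?thesis by (simp add: filterlim_cong)
qed

lemma ln_ratio_tendsto_if_log_derivative:
  fixes f f' :: "real \<Rightarrow> real"
  assumes pos: "\<forall>\<^sub>F s in at_top. 0 < f s"
    and der: "\<forall>\<^sub>F s in at_top. (f has_real_derivative f' s) (at s)"
    and lim: "((\<lambda>s. s * f' s / f s) \<longlongrightarrow> \<rho>) at_top"
  shows "((\<lambda>s. ln (f s) / ln s) \<longlongrightarrow> \<rho>) at_top"
proof (rule lhospital_at_top_at_top[OF ln_at_top])
  show "\<forall>\<^sub>F s in at_top. inverse s \<noteq> (0 :: real)"
    using eventually_gt_at_top[of 0] by eventually_elim auto
  show "\<forall>\<^sub>F s in at_top. ((\<lambda>s. ln (f s)) has_real_derivative f' s / f s) (at s)"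
    using pos der by eventually_elim (auto intro!: derivative_eq_intros)
  show "\<forall>\<^sub>F s in at_top. (ln has_real_derivative inverse s) (at s)"
    using eventually_gt_at_top[of 0] by eventually_elim (rule DERIV_ln)
  show "((\<lambda>s. f' s / f s / inverse s) \<longlongrightarrow> \<rho>) at_top"
    using lim by (simp add: field_simps)
qed

text \<open>The quotient is \<open>exp ((ln (f s) / ln s - c) * ln s)\<close>, and the sign of \<open>\<rho> -
  c\<close> decides the limit of the exponent.\<close>

lemma
  fixes f :: "real \<Rightarrow> real"
  assumes pos: "\<forall>\<^sub>F s in at_top. 0 < f s"
    and lim: "((\<lambda>s. ln (f s) / ln s) \<longlongrightarrow> \<rho>) at_top"
  shows over_powr_at_top: "c < \<rho> \<Longrightarrow> filterlim (\<lambda>s. f s / s powr c) at_top at_top"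
    and over_powr_tendsto_0: "\<rho> < c \<Longrightarrow> ((\<lambda>s. f s / s powr c) \<longlongrightarrow> 0) at_top"
proof -
  have eq: "\<forall>\<^sub>F s in at_top. exp ((ln (f s) / ln s - c) * ln s) = f s / s powr c"
    using pos eventually_gt_at_top[of 1]
    by eventually_elim (simp add: left_diff_distrib exp_diff powr_def)
  have lim': "((\<lambda>s. ln (f s) / ln s - c) \<longlongrightarrow> \<rho> - c) at_top"
    by (intro tendsto_intros lim)
  show "filterlim (\<lambda>s. f s / s powr c) at_top at_top" if "c < \<rho>"
  proof -
    have "filterlim (\<lambda>s. exp ((ln (f s) / ln s - c) * ln s)) at_top at_top"
      using that by (intro filterlim_compose[OF exp_at_top] filterlim_tendsto_pos_mult_at_top[OF lim' _ ln_at_top]) simp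
    then show ?thesis by (rule filterlim_cong[OF refl refl eq, THEN iffD1])
  qed
  show "((\<lambda>s. f s / s powr c) \<longlongrightarrow> 0) at_top" if "\<rho> < c"
  proof -
    have "((\<lambda>s. exp ((ln (f s) / ln s - c) * ln s)) \<longlongrightarrow> 0) at_top"
      using that by (intro filterlim_compose[OF exp_at_bot] filterlim_tendsto_neg_mult_at_bot[OF lim' _ ln_at_top]) simp
    then show ?thesis by (rule filterlim_cong[OF refl refl eq, THEN iffD1])
  qed
qed

text \<open>The variance is treated by comparison with the square of the policy rather than by its own
  derivative, which need not exist at atoms of the offer distribution.\<close>

lemma regularly_varying_if_asymptotic_to_square:
  fixes f V :: "real \<Rightarrow> real"
  assumes V: "V \<in> borel_measurable (restrict_space borel {0..})" "\<And>t. 0 \<le> t \<Longrightarrow> 0 \<le> V t"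
    and pos: "\<forall>\<^sub>F s in at_top. 0 < f s"
    and ratio: "\<And>x. 0 < x \<Longrightarrow> ((\<lambda>s. f (x * s) / f s) \<longlongrightarrow> x powr \<rho>) at_top"
    and lim: "((\<lambda>s. V s / (f s)\<^sup>2) \<longlongrightarrow> C) at_top" and "0 < C"
  shows "regularly_varying V (2 * \<rho>)"
  unfolding regularly_varying_def
proof (intro conjI allI impI V)
  fix x :: real assume x: "0 < x"
  have mult: "filterlim (\<lambda>s. x * s) at_top at_top"
    by (rule filterlim_tendsto_pos_mult_at_top[OF tendsto_const x filterlim_ident])
  have "((\<lambda>s. (V (x * s) / (f (x * s))\<^sup>2) / (V s / (f s)\<^sup>2) * (f (x * s) / f s)\<^sup>2)
      \<longlongrightarrow> C / C * (x powr \<rho>)\<^sup>2) at_top"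
    using \<open>0 < C\<close> by (intro tendsto_intros lim ratio x filterlim_compose[OF lim mult]) auto
  moreover have "C / C * (x powr \<rho>)\<^sup>2 = x powr (2 * \<rho>)"
    using \<open>0 < C\<close> x by (simp add: powr_powr[symmetric] powr_numeral mult.commute[of 2])
  moreover have "\<forall>\<^sub>F s in at_top. (V (x * s) / (f (x * s))\<^sup>2) / (V s / (f s)\<^sup>2) * (f (x * s) / f s)\<^sup>2 = V (x * s) / V s"
    using pos eventually_compose_filterlim[OF pos mult]
    by eventually_elim (simp add: power_divide)
  ultimately show "((\<lambda>s. V (x * s) / V s) \<longlongrightarrow> x powr (2 * \<rho>)) at_top"
    by (simp add: filterlim_cong)
qed

lemma
  fixes f V :: "real \<Rightarrow> real"
  assumes pos: "\<forall>\<^sub>F s in at_top. 0 < f s"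
    and ln_lim: "((\<lambda>s. ln (f s) / ln s) \<longlongrightarrow> \<rho>) at_top"
    and lim: "((\<lambda>s. V s / (f s)\<^sup>2) \<longlongrightarrow> C) at_top" and "0 < C"
  shows asymptotic_to_square_over_powr_at_top:
      "c < 2 * \<rho> \<Longrightarrow> filterlim (\<lambda>s. V s / s powr c) at_top at_top"
    and asymptotic_to_square_over_powr_tendsto_0:
      "2 * \<rho> < c \<Longrightarrow> ((\<lambda>s. V s / s powr c) \<longlongrightarrow> 0) at_top"
proof -
  have eq: "\<forall>\<^sub>F s in at_top. V s / (f s)\<^sup>2 * (f s / s powr (c / 2))\<^sup>2 = V s / s powr c"
    using pos eventually_gt_at_top[of 0]
    by eventually_elim (simp add: power_divide powr_power)
  show "filterlim (\<lambda>s. V s / s powr c) at_top at_top" if "c < 2 * \<rho>"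
  proof -
    have "filterlim (\<lambda>s. V s / (f s)\<^sup>2 * (f s / s powr (c / 2))\<^sup>2) at_top at_top"
      using that
      by (intro filterlim_tendsto_pos_mult_at_top[OF lim \<open>0 < C\<close>] filterlim_pow_at_top
          over_powr_at_top[OF pos ln_lim]) auto
    then show ?thesis by (rule filterlim_cong[OF refl refl eq, THEN iffD1])
  qed
  show "((\<lambda>s. V s / s powr c) \<longlongrightarrow> 0) at_top" if "2 * \<rho> < c"
  proof -
    have "((\<lambda>s. V s / (f s)\<^sup>2 * (f s / s powr (c / 2))\<^sup>2) \<longlongrightarrow> C * 0\<^sup>2) at_top"
      using that by (intro tendsto_intros lim over_powr_tendsto_0[OF pos ln_lim]) auto
    then show ?thesis using filterlim_cong[OF refl refl eq, THEN iffD1] by simp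
  qed
qed

section \<open>The expected excess and its integral\<close>

definition Phi :: "real measure \<Rightarrow> real \<Rightarrow> real" where
  "Phi F x = (LBINT u:{x..}. phi F u)"

locale offer_law = real_distribution F for F :: "real measure" +
  assumes integrable_pos_part: "integrable F (\<lambda>y. max y 0)"
    and cdf_less_1: "cdf F x < 1"
    and integrable_phi: "set_integrable lborel {x..} (phi F)"
begin

lemma measurable_cdf [measurable]: "cdf F \<in> borel_measurable borel"
  by (intro borel_measurable_mono monoI cdf_nondecreasing)

lemma integrable_excess [simp]: "integrable F (\<lambda>y. max (y - x) 0)"
proof (rule Bochner_Integration.integrable_bound)
  show "integrable F (\<lambda>y. max y 0 + \<bar>x\<bar>)"
    using integrable_pos_part by auto
qed (auto intro!: AE_I2)

text \<open>Write \<open>1 - cdf F u\<close> as the expectation of the indicator of \<open>u < y\<close> and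
  exchange the integrals (Tonelli).\<close>

lemma phi_eq_expectation: "phi F x = (\<integral>y. max (y - x) 0 \<partial>F)"
proof -
  interpret L: pair_sigma_finite lborel F
    by (intro pair_sigma_finite.intro lborel.sigma_finite_measure_axioms sigma_finite_measure_axioms)
  have tail: "ennreal (1 - cdf F u) = emeasure F {u<..}" for u
  proof -
    have "prob (UNIV - {..u}) = 1 - prob {..u}"
      using prob_compl[of "{..u}"] by simp
    moreover have "UNIV - {..u} = {u<..}" by auto
    ultimately show ?thesis by (simp add: cdf_def emeasure_eq_measure)
  qed
  have inner: "(\<integral>\<^sup>+u. indicator {x..} u * indicator {u<..} y \<partial>lborel) = ennreal (max (y - x) 0)" for y
  proof -
    have "(\<integral>\<^sup>+u. indicator {x..} u * indicator {u<..} y \<partial>lborel)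
        = (\<integral>\<^sup>+u. indicator {x..<y} u \<partial>lborel)"
      by (intro nn_integral_cong) (auto simp: indicator_def)
    also have "\<dots> = emeasure lborel {x..<y}" by simp
    also have "\<dots> = ennreal (max (y - x) 0)"
      by (cases "x \<le> y") (auto simp: max_def)
    finally show ?thesis .
  qed
  have "(\<integral>\<^sup>+u. ennreal (indicator {x..} u *\<^sub>R (1 - cdf F u)) \<partial>lborel)
      = (\<integral>\<^sup>+u. (\<integral>\<^sup>+y. indicator {x..} u * indicator {u<..} y \<partial>F) \<partial>lborel)"
    by (intro nn_integral_cong) (simp add: nn_integral_cmult tail split: split_indicator)
  also have "\<dots> = (\<integral>\<^sup>+y. (\<integral>\<^sup>+u. indicator {x..} u * indicator {u<..} y \<partial>lborel) \<partial>F)"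
  proof (rule L.Fubini'[symmetric])
    have "{z \<in> space (borel \<Otimes>\<^sub>M borel). fst z < (snd z :: real)} \<in> sets (borel \<Otimes>\<^sub>M borel)"
      by measurable
    then have [measurable]: "{z :: real \<times> real. fst z < snd z} \<in> sets (borel \<Otimes>\<^sub>M borel)"
      by (simp add: space_pair_measure)
    have "(\<lambda>(u, y). indicator {x..} u * indicator {u<..} y)
        = (\<lambda>z. indicator {x..} (fst z) * indicator {z. fst z < snd z} z :: ennreal)"
      by (auto simp: indicator_def)
    also have "\<dots> \<in> borel_measurable (lborel \<Otimes>\<^sub>M F)"
      by measurable
    finally show "(\<lambda>(u, y). indicator {x..} u * indicator {u<..} y :: ennreal) \<in> borel_measurable (lborel \<Otimes>\<^sub>M F)" .
  qed
  also have "\<dots> = (\<integral>\<^sup>+y. ennreal (max (y - x) 0) \<partial>F)"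
    by (simp only: inner)
  finally have *: "(\<integral>\<^sup>+u. ennreal (indicator {x..} u *\<^sub>R (1 - cdf F u)) \<partial>lborel)
      = (\<integral>\<^sup>+y. ennreal (max (y - x) 0) \<partial>F)" .
  have "phi F x = enn2real (\<integral>\<^sup>+u. ennreal (indicator {x..} u *\<^sub>R (1 - cdf F u)) \<partial>lborel)"
    unfolding phi_def set_lebesgue_integral_def
    using cdf_bounded_prob by (intro integral_eq_nn_integral) (auto simp: indicator_def)
  also have "\<dots> = (\<integral>y. max (y - x) 0 \<partial>F)"
    unfolding * by (intro integral_eq_nn_integral[symmetric]) auto
  finally show ?thesis .
qed

lemma phi_lipschitz: "\<bar>phi F x - phi F x'\<bar> \<le> \<bar>x - x'\<bar>"
proof -
  have "\<bar>phi F x - phi F x'\<bar> = \<bar>\<integral>y. max (y - x) 0 - max (y - x') 0 \<partial>F\<bar>"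
    by (simp add: phi_eq_expectation)
  also have "\<dots> \<le> (\<integral>y. \<bar>max (y - x) 0 - max (y - x') 0\<bar> \<partial>F)"
    by (rule integral_abs_bound)
  also have "\<dots> \<le> (\<integral>y. \<bar>x - x'\<bar> \<partial>F)"
    by (intro integral_mono) auto
  finally show ?thesis using prob_space by simp
qed

lemma continuous_on_phi: "continuous_on A (phi F)"
  by (rule continuous_on_subset[of UNIV], rule lipschitz_on_continuous_on[of 1])
     (auto intro!: lipschitz_onI simp: dist_real_def phi_lipschitz)

lemma measurable_phi [measurable]: "phi F \<in> borel_measurable borel"
  using continuous_on_phi by (rule borel_measurable_continuous_onI)

lemma expectation_pos_if_pos_above:
  fixes f :: "real \<Rightarrow> real"
  assumes "integrable F f" "\<And>y. 0 \<le> f y" "\<And>y. x < y \<Longrightarrow> 0 < f y"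
  shows "0 < (\<integral>y. f y \<partial>F)"
proof -
  have "\<not> (AE y in F. f y = 0)"
  proof
    assume "AE y in F. f y = 0"
    then have "AE y in F. y \<in> {..x}"
      by eventually_elim (metis assms(3) atMost_iff less_irrefl not_le)
    then have "prob {..x} = 1" by (intro prob_eq_1[THEN iffD2]) auto
    then show False using cdf_less_1[of x] by (simp add: cdf_def)
  qed
  then have "(\<integral>y. f y \<partial>F) \<noteq> 0"
    using assms by (simp add: integral_nonneg_eq_0_iff_AE)
  moreover have "0 \<le> (\<integral>y. f y \<partial>F)" using assms by simp
  ultimately show ?thesis by simp
qed

lemma phi_pos: "0 < phi F x"
  unfolding phi_eq_expectation by (rule expectation_pos_if_pos_above[where x = x]) auto

lemma phi_nonneg: "0 \<le> phi F x"
  using phi_pos[of x] by simp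

lemma phi_neq_0 [simp]: "phi F x \<noteq> 0"
  using phi_pos[of x] by simp

text \<open>A second application of Tonelli's theorem: integrating \<open>(y - u)\<^sub>+\<close> over
  \<open>u \<ge> x\<close> gives half of the square. Integrability of \<open>\<phi>\<close> thus amounts to a
  finite second moment of the positive part of the offers.\<close>

lemma nn_integral_square_excess:
  "(\<integral>\<^sup>+y. ennreal ((max (y - x) 0)\<^sup>2 / 2) \<partial>F) = ennreal (Phi F x)"
proof -
  interpret L: pair_sigma_finite lborel F
    by (intro pair_sigma_finite.intro lborel.sigma_finite_measure_axioms sigma_finite_measure_axioms)
  have inner: "(\<integral>\<^sup>+u. indicator {x..} u * ennreal (max (y - u) 0) \<partial>lborel)
      = ennreal ((max (y - x) 0)\<^sup>2 / 2)" for y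
  proof -
    have "(\<integral>\<^sup>+u. indicator {x..} u * ennreal (max (y - u) 0) \<partial>lborel)
        = (\<integral>\<^sup>+u. ennreal (y - u) * indicator {x..y} u \<partial>lborel)"
      by (intro nn_integral_cong) (auto simp: indicator_def max_def)
    also have "\<dots> = ennreal ((max (y - x) 0)\<^sup>2 / 2)"
    proof (cases "x \<le> y")
      case True
      have "(\<integral>\<^sup>+u. ennreal (y - u) * indicator {x..y} u \<partial>lborel)
          = ennreal (- ((y - y)\<^sup>2 / 2) - - ((y - x)\<^sup>2 / 2))"
        using True by (intro nn_integral_FTC_Icc) (auto intro!: derivative_eq_intros simp: field_simps)
      then show ?thesis using True by simp
    qed auto
    finally show ?thesis .
  qed
  have "ennreal (Phi F x) = (\<integral>\<^sup>+u. ennreal (indicator {x..} u *\<^sub>R phi F u) \<partial>lborel)"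
    unfolding Phi_def set_lebesgue_integral_def
    using integrable_phi[of x] phi_nonneg unfolding set_integrable_def
    by (intro nn_integral_eq_integral[symmetric]) (auto intro!: AE_I2 mult_nonneg_nonneg)
  also have "\<dots> = (\<integral>\<^sup>+u. (\<integral>\<^sup>+y. indicator {x..} u * ennreal (max (y - u) 0) \<partial>F) \<partial>lborel)"
  proof (intro nn_integral_cong)
    fix u
    have "ennreal (phi F u) = (\<integral>\<^sup>+y. ennreal (max (y - u) 0) \<partial>F)"
      unfolding phi_eq_expectation by (intro nn_integral_eq_integral[symmetric]) auto
    then show "ennreal (indicator {x..} u *\<^sub>R phi F u)
        = (\<integral>\<^sup>+y. indicator {x..} u * ennreal (max (y - u) 0) \<partial>F)"
      by (simp add: nn_integral_cmult indicator_def)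
  qed
  also have "\<dots> = (\<integral>\<^sup>+y. (\<integral>\<^sup>+u. indicator {x..} u * ennreal (max (y - u) 0) \<partial>lborel) \<partial>F)"
    by (rule L.Fubini'[symmetric]) measurable
  finally show ?thesis by (simp only: inner)
qed

lemma integrable_square_excess [simp]: "integrable F (\<lambda>y. (max (y - x) 0)\<^sup>2)"
proof -
  have "integrable F (\<lambda>y. (max (y - x) 0)\<^sup>2 / 2)"
    by (rule integrableI_nonneg) (auto simp: nn_integral_square_excess)
  from integrable_mult_right[OF this, of 2] show ?thesis by simp
qed

lemma Phi_eq_expectation: "Phi F x = (\<integral>y. (max (y - x) 0)\<^sup>2 \<partial>F) / 2"
proof -
  have nn: "0 \<le> Phi F x"
    unfolding Phi_def set_lebesgue_integral_def
    using phi_nonneg by (intro Bochner_Integration.integral_nonneg) auto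
  have "ennreal (\<integral>y. (max (y - x) 0)\<^sup>2 / 2 \<partial>F) = ennreal (Phi F x)"
    unfolding nn_integral_square_excess[symmetric]
    by (rule nn_integral_eq_integral[symmetric]) auto
  then show ?thesis using nn by simp
qed

lemma Phi_pos: "0 < Phi F x"
  unfolding Phi_eq_expectation
  using expectation_pos_if_pos_above[of "\<lambda>y. (max (y - x) 0)\<^sup>2" x] by simp

lemma Phi_neq_0 [simp]: "Phi F x \<noteq> 0"
  using Phi_pos[of x] by simp

lemma phi_antimono: "x \<le> y \<Longrightarrow> phi F y \<le> phi F x"
  unfolding phi_eq_expectation by (intro integral_mono) auto

lemma Phi_antimono: "x \<le> y \<Longrightarrow> Phi F y \<le> Phi F x"
  unfolding Phi_eq_expectation by (intro divide_right_mono integral_mono power_mono) auto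

lemma DERIV_Phi: "(Phi F has_real_derivative - phi F x) (at x)"
proof -
  have *: "Phi F y = Phi F (x - 1) - integral {x - 1..y} (phi F)" if "x - 1 \<le> y" for y
  proof -
    have "Phi F (x - 1) = (LBINT u:{x - 1..y} \<union> {y..}. phi F u)"
      unfolding Phi_def using that by (auto intro!: arg_cong2[where f = "set_lebesgue_integral lborel"])
    also have "\<dots> = (LBINT u:{x - 1..y}. phi F u) + Phi F y"
      unfolding Phi_def
    proof (rule set_integral_Un_AE)
      show "AE u in lborel. \<not> (u \<in> {x - 1..y} \<and> u \<in> {y..})"
        using AE_lborel_singleton[of y] by eventually_elim auto
    qed (use that in \<open>auto intro!: set_integrable_subset[OF integrable_phi[of "x - 1"]]\<close>)
    also have "(LBINT u:{x - 1..y}. phi F u) = integral {x - 1..y} (phi F)"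
      by (intro set_borel_integral_eq_integral set_integrable_subset[OF integrable_phi[of "x - 1"]]) auto
    finally show ?thesis by simp
  qed
  have "((\<lambda>y. integral {x - 1..y} (phi F)) has_real_derivative phi F x) (at x within {x - 1..x + 1})"
    by (intro integral_has_real_derivative continuous_on_phi) auto
  then have "((\<lambda>y. integral {x - 1..y} (phi F)) has_real_derivative phi F x) (at x)"
    by (simp add: at_within_Icc_at)
  then have "((\<lambda>y. Phi F (x - 1) - integral {x - 1..y} (phi F)) has_real_derivative - phi F x) (at x)"
    using DERIV_diff[OF DERIV_const] by fastforce
  then show ?thesis
  proof (rule has_field_derivative_transform_within_open)
    show "Phi F (x - 1) - integral {x - 1..y} (phi F) = Phi F y" if "y \<in> {x - 1<..}" for y
      by (rule *[symmetric]) (use that in simp)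
  qed auto
qed

lemma continuous_on_Phi: "continuous_on A (Phi F)"
  by (rule DERIV_continuous_on) (rule DERIV_subset[OF DERIV_Phi subset_UNIV])

end

section \<open>The optimal policy\<close>

text \<open>Starting the integral at \<open>a - 1\<close> and subtracting the part before \<open>a\<close>
  makes the primitive two-sided differentiable at \<open>a\<close> itself, which the substitution theorem for
  the Lebesgue integral asks for at end points.\<close>

definition primitive :: "real \<Rightarrow> (real \<Rightarrow> real) \<Rightarrow> real \<Rightarrow> real" where
  "primitive a g x = integral {a - 1..x} g - integral {a - 1..a} g"

lemma DERIV_primitive:
  assumes "continuous_on UNIV g" "a \<le> x"
  shows "(primitive a g has_real_derivative g x) (at x)"
proof -
  have "((\<lambda>y. integral {a - 1..y} g) has_real_derivative g x) (at x within {a - 1..x + 1})"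
    using assms by (intro integral_has_real_derivative continuous_on_subset[OF assms(1)]) auto
  then have "((\<lambda>y. integral {a - 1..y} g) has_real_derivative g x) (at x)"
    using assms by (simp add: at_within_Icc_at)
  then show ?thesis
    unfolding primitive_def by (auto intro!: derivative_eq_intros)
qed

lemma primitive_self [simp]: "primitive a g a = 0"
  by (simp add: primitive_def)

lemma primitive_eq_LBINT:
  assumes "continuous_on UNIV g" "a \<le> x"
  shows "primitive a g x = (LBINT u:{a..x}. g u)"
proof -
  have "(LBINT u:{a..x}. g u) = primitive a g x - primitive a g a"
    unfolding set_lebesgue_integral_def
    using assms(2)
    by (intro integral_FTC_atLeastAtMost continuous_on_subset[OF assms(1)])
       (auto simp: has_real_derivative_iff_has_vector_derivative[symmetric]
             intro!: DERIV_subset[OF DERIV_primitive] assms(1))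
  then show ?thesis by simp
qed

lemma (in offer_law) upper_end_eq_infinity: "upper_end F = \<infinity>"
  unfolding upper_end_def using cdf_less_1 by (intro SUP_PInfty) (auto simp: cdf_less_1)

locale optimal_selling = offer_law F for F :: "real measure" +
  fixes lam :: real and F0 :: "real measure"
  assumes lam_pos: "0 < lam"
begin

abbreviation m0 :: real where "m0 \<equiv> residual_mean F0"
abbreviation \<mu> :: "real \<Rightarrow> real" where "\<mu> \<equiv> optimal_policy lam F F0"

text \<open>This agrees with \<open>Psi F F0\<close> on \<open>[m0, \<infinity>)\<close> but is differentiable
  at \<open>m0\<close> as well.\<close>

definition Psi_ext :: "real \<Rightarrow> real" where
  "Psi_ext = primitive m0 (\<lambda>u. 1 / phi F u)"

lemma continuous_inverse_phi: "continuous_on A (\<lambda>u. 1 / phi F u)"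
  using phi_pos by (intro continuous_intros continuous_on_phi) (auto simp: less_le)

lemma DERIV_Psi_ext: "m0 \<le> x \<Longrightarrow> (Psi_ext has_real_derivative 1 / phi F x) (at x)"
  unfolding Psi_ext_def by (rule DERIV_primitive[OF continuous_inverse_phi])

lemma Psi_ext_m0 [simp]: "Psi_ext m0 = 0"
  by (simp add: Psi_ext_def)

lemma Psi_eq_Psi_ext: "m0 \<le> x \<Longrightarrow> Psi F F0 x = Psi_ext x"
  unfolding Psi_def Psi_ext_def by (rule primitive_eq_LBINT[OF continuous_inverse_phi, symmetric])

lemma continuous_on_Psi_ext: "continuous_on {m0..} Psi_ext"
  by (rule DERIV_continuous_on[where D = "\<lambda>x. 1 / phi F x"]) (auto intro: DERIV_subset[OF DERIV_Psi_ext])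

lemma Psi_ext_strict_mono: "m0 \<le> x \<Longrightarrow> x < y \<Longrightarrow> Psi_ext x < Psi_ext y"
  by (rule DERIV_pos_imp_increasing, assumption, rule exI, rule conjI, rule DERIV_Psi_ext) (auto simp: phi_pos)

lemma Psi_ext_le_iff: "m0 \<le> x \<Longrightarrow> m0 \<le> y \<Longrightarrow> Psi_ext x \<le> Psi_ext y \<longleftrightarrow> x \<le> y"
  using Psi_ext_strict_mono[of x y] Psi_ext_strict_mono[of y x] by (cases x y rule: linorder_cases) auto

lemma Psi_ext_eq_iff: "m0 \<le> x \<Longrightarrow> m0 \<le> y \<Longrightarrow> Psi_ext x = Psi_ext y \<longleftrightarrow> x = y"
  using Psi_ext_le_iff[of x y] Psi_ext_le_iff[of y x] by auto

text \<open>Since \<open>\<phi>\<close> decreases, \<open>1 / \<phi>\<close> stays above its initial value;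
  hence \<open>\<Psi>\<close> is unbounded and the policy is defined for all times.\<close>

lemma Psi_ext_lower_bound:
  assumes "m0 \<le> x"
  shows "(x - m0) / phi F m0 \<le> Psi_ext x"
proof -
  have "Psi_ext m0 - m0 / phi F m0 \<le> Psi_ext x - x / phi F m0"
  proof (rule DERIV_nonneg_imp_nondecreasing[OF assms])
    fix y assume y: "m0 \<le> y" "y \<le> x"
    then have "((\<lambda>x. Psi_ext x - x / phi F m0) has_real_derivative 1 / phi F y - 1 / phi F m0) (at y)"
      by (auto intro!: derivative_eq_intros DERIV_Psi_ext)
    moreover have "0 \<le> 1 / phi F y - 1 / phi F m0"
      using phi_antimono[OF y(1)] phi_pos[of y] phi_pos[of m0] by (simp add: frac_le)
    ultimately show "\<exists>z. ((\<lambda>x. Psi_ext x - x / phi F m0) has_real_derivative z) (at y) \<and> 0 \<le> z"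
      by blast
  qed
  then show ?thesis by (simp add: diff_divide_distrib)
qed

lemma Psi_ext_surj:
  assumes "0 \<le> y"
  shows "\<exists>x\<ge>m0. Psi_ext x = y"
proof -
  define b where "b = m0 + y * phi F m0"
  have b: "m0 \<le> b" using assms phi_nonneg by (simp add: b_def)
  have "y \<le> Psi_ext b" using Psi_ext_lower_bound[OF b] phi_pos[of m0] by (simp add: b_def)
  then show ?thesis
    using IVT'[of Psi_ext m0 y b] assms b continuous_on_subset[OF continuous_on_Psi_ext, of "{m0..b}"] by auto
qed

lemma
  assumes "0 \<le> t"
  shows m0_le_\<mu>: "m0 \<le> \<mu> t" and Psi_ext_\<mu>: "Psi_ext (\<mu> t) = lam * t"
proof -
  have "0 \<le> lam * t" using assms lam_pos by simp
  then obtain x where "m0 \<le> x" "Psi_ext x = lam * t" using Psi_ext_surj by blast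
  then have "lam * t \<in> Psi F F0 ` {x. m0 \<le> x \<and> ereal x < upper_end F}"
    by (auto simp: image_iff upper_end_eq_infinity Psi_eq_Psi_ext intro!: exI[of _ x])
  from inv_into_into[OF this] f_inv_into_f[OF this]
  show "m0 \<le> \<mu> t" "Psi_ext (\<mu> t) = lam * t"
    unfolding optimal_policy_def by (auto simp: Psi_eq_Psi_ext)
qed

lemma \<mu>_eqI: "m0 \<le> x \<Longrightarrow> Psi_ext x = lam * t \<Longrightarrow> \<mu> t = x"
proof -
  assume *: "m0 \<le> x" "Psi_ext x = lam * t"
  then have "0 \<le> lam * t" using Psi_ext_le_iff[of m0 x] by simp
  then have "0 \<le> t" using lam_pos by (simp add: zero_le_mult_iff)
  then show ?thesis using * Psi_ext_eq_iff m0_le_\<mu> Psi_ext_\<mu> by metis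
qed

lemma \<mu>_0 [simp]: "\<mu> 0 = m0"
  by (rule \<mu>_eqI) auto

lemma \<mu>_mono: "0 \<le> s \<Longrightarrow> s \<le> t \<Longrightarrow> \<mu> s \<le> \<mu> t"
  using Psi_ext_le_iff[of "\<mu> s" "\<mu> t"] m0_le_\<mu>[of s] m0_le_\<mu>[of t] Psi_ext_\<mu>[of s] Psi_ext_\<mu>[of t] lam_pos
  by (simp add: mult_left_mono)

lemma \<mu>_at_top: "filterlim \<mu> at_top at_top"
  unfolding filterlim_at_top
proof
  fix Z
  let ?z = "max Z m0"
  show "\<forall>\<^sub>F t in at_top. Z \<le> \<mu> t"
    using eventually_ge_at_top[of 0] eventually_ge_at_top[of "Psi_ext ?z / lam"]
  proof eventually_elim
    case (elim t)
    then have "Psi_ext ?z \<le> Psi_ext (\<mu> t)" using lam_pos Psi_ext_\<mu>[of t] by (simp add: field_simps)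
    then have "?z \<le> \<mu> t" using Psi_ext_le_iff[of ?z "\<mu> t"] m0_le_\<mu>[of t] elim by simp
    then show ?case by simp
  qed
qed

lemma measurable_\<mu>_max [measurable]: "(\<lambda>t. \<mu> (max t 0)) \<in> borel_measurable borel"
  by (intro borel_measurable_mono monoI \<mu>_mono) auto

text \<open>A monotone function with open image has no jumps.\<close>

lemma continuous_on_\<mu>: "continuous_on {0<..} \<mu>"
proof (rule continuous_onI_mono)
  have "\<mu> ` {0<..} = {m0<..}"
  proof (intro equalityI subsetI)
    fix x assume "x \<in> \<mu> ` {0<..}"
    then obtain t where t: "0 < t" "x = \<mu> t" by auto
    then have "\<mu> t \<noteq> m0"
      using Psi_ext_\<mu>[of t] lam_pos by (metis Psi_ext_m0 less_imp_le less_irrefl mult_pos_pos)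
    then show "x \<in> {m0<..}" using m0_le_\<mu>[of t] t by simp
  next
    fix x assume x: "x \<in> {m0<..}"
    then have "\<mu> (Psi_ext x / lam) = x" using lam_pos by (intro \<mu>_eqI) auto
    moreover have "0 < Psi_ext x / lam" using Psi_ext_strict_mono[of m0 x] x lam_pos by simp
    ultimately show "x \<in> \<mu> ` {0<..}" by (metis greaterThan_iff image_eqI)
  qed
  then show "open (\<mu> ` {0<..})" by simp
qed (auto intro: \<mu>_mono)

lemma DERIV_\<mu>:
  assumes "0 < t"
  shows "(\<mu> has_real_derivative lam * phi F (\<mu> t)) (at t)"
proof -
  have "(\<mu> has_real_derivative inverse (1 / phi F (\<mu> t) / lam)) (at t)"
  proof (rule DERIV_inverse_function[of "\<lambda>x. Psi_ext x / lam" _ _ _ 0 "t + 1"])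
    show "((\<lambda>x. Psi_ext x / lam) has_real_derivative 1 / phi F (\<mu> t) / lam) (at (\<mu> t))"
      using lam_pos assms m0_le_\<mu>[of t] by (auto intro!: derivative_eq_intros DERIV_Psi_ext)
    show "1 / phi F (\<mu> t) / lam \<noteq> 0" using lam_pos phi_pos[of "\<mu> t"] by simp
    show "isCont \<mu> t" using continuous_on_\<mu> assms
      by (simp add: continuous_on_eq_continuous_at)
    show "Psi_ext (\<mu> y) / lam = y" if "0 < y" for y
      using Psi_ext_\<mu>[of y] that lam_pos by simp
  qed (use assms in simp_all)
  then show ?thesis using lam_pos by (simp add: field_simps)
qed

end

section \<open>Growth of the policy and of the variance formula\<close>

context optimal_selling
begin

text \<open>The solution of \<open>(v / \<phi>)' = 2 \<Phi> / \<phi>^2\<close>: when the threshold is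
  \<open>u\<close>, the variance of the sale price is \<open>\<phi>(u)\<close> times this value. The parameter
  \<open>v0\<close> is the variance of the residual price.\<close>

definition scaled_variance :: "real \<Rightarrow> real \<Rightarrow> real" where
  "scaled_variance v0 = (\<lambda>u. v0 / phi F m0 + primitive m0 (\<lambda>u. 2 * Phi F u / (phi F u)\<^sup>2) u)"

lemma scaled_variance_m0 [simp]: "scaled_variance v0 m0 = v0 / phi F m0"
  by (simp add: scaled_variance_def)

lemma DERIV_scaled_variance: "m0 \<le> x \<Longrightarrow> (scaled_variance v0 has_real_derivative 2 * Phi F x / (phi F x)\<^sup>2) (at x)"
proof -
  assume x: "m0 \<le> x"
  have "continuous_on UNIV (\<lambda>u. 2 * Phi F u / (phi F u)\<^sup>2)"
    by (intro continuous_on_divide continuous_on_mult continuous_on_power continuous_on_const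
        continuous_on_phi continuous_on_Phi) simp
  from DERIV_primitive[OF this x] show ?thesis
    unfolding scaled_variance_def by (auto intro: DERIV_add[OF DERIV_const, simplified])
qed

lemma scaled_variance_nonneg:
  assumes "m0 \<le> x" "0 \<le> v0"
  shows "0 \<le> scaled_variance v0 x"
proof -
  have "0 \<le> scaled_variance v0 m0" using assms(2) phi_nonneg by simp
  also have "scaled_variance v0 m0 \<le> scaled_variance v0 x"
    by (rule DERIV_nonneg_imp_nondecreasing[OF assms(1)], rule exI, rule conjI, rule DERIV_scaled_variance)
       (auto simp: less_imp_le[OF Phi_pos])
  finally show ?thesis .
qed

lemma eventually_\<mu>_pos: "\<forall>\<^sub>F t in at_top. 0 < \<mu> t"
  using filterlim_at_top_dense[THEN iffD1, OF \<mu>_at_top] by blast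

lemma eventually_DERIV_\<mu>: "\<forall>\<^sub>F t in at_top. (\<mu> has_real_derivative lam * phi F (\<mu> t)) (at t)"
  using eventually_gt_at_top[of 0] by eventually_elim (rule DERIV_\<mu>)

lemma power_over_Phi_at_top: "0 < n \<Longrightarrow> filterlim (\<lambda>s. s ^ n / Phi F s) at_top at_top"
proof (rule filterlim_at_top_mono)
  assume "0 < n"
  then show "filterlim (\<lambda>s. s ^ n / Phi F 0) at_top at_top"
    unfolding divide_inverse using Phi_pos[of 0]
    by (intro filterlim_at_top_mult_tendsto_pos[OF tendsto_const] filterlim_pow_at_top filterlim_ident) auto
  show "\<forall>\<^sub>F s in at_top. s ^ n / Phi F 0 \<le> s ^ n / Phi F s"
    using eventually_ge_at_top[of 0] by eventually_elim (intro divide_left_mono; simp add: Phi_antimono Phi_pos)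
qed

context
  fixes p :: real
  assumes p_pos: "0 < p"
    and lim_e: "((\<lambda>x. x * phi F x / Phi F x) \<longlongrightarrow> p) at_top"
begin

text \<open>With \<open>e = s \<phi> / \<Phi>\<close>, the derivative of \<open>s^2 / \<Phi>\<close> is
  \<open>e (2 + e) / \<phi>\<close>, while that of \<open>\<Psi>\<close> is \<open>1 / \<phi>\<close>.
  Dividing by \<open>\<Phi>\<close>, whose derivative \<open>- \<phi>\<close> is continuous, rather than by
  \<open>\<phi>\<close> keeps the survival function out of the computation.\<close>

lemma Psi_ext_asymptotics: "((\<lambda>s. Psi_ext s / (s ^ 2 / Phi F s)) \<longlongrightarrow> 1 / (p * (2 + p))) at_top"
proof (rule lhospital_at_top_at_top[OF power_over_Phi_at_top])
  define e where "e s = s * phi F s / Phi F s" for s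
  let ?g' = "\<lambda>s. (2 * s * Phi F s + s ^ 2 * phi F s) / (Phi F s)\<^sup>2"
  show "\<forall>\<^sub>F s in at_top. (Psi_ext has_real_derivative 1 / phi F s) (at s)"
    using eventually_ge_at_top[of m0] by eventually_elim (rule DERIV_Psi_ext)
  show "\<forall>\<^sub>F s in at_top. ((\<lambda>s. s ^ 2 / Phi F s) has_real_derivative ?g' s) (at s)"
    by (intro always_eventually allI)
       (auto intro!: derivative_eq_intros DERIV_Phi simp: field_simps power2_eq_square)
  show "\<forall>\<^sub>F s in at_top. ?g' s \<noteq> 0"
    using eventually_gt_at_top[of 0]
  proof eventually_elim
    case (elim s)
    then have "0 < ?g' s"
      by (intro divide_pos_pos add_pos_pos mult_pos_pos phi_pos Phi_pos zero_less_power) auto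
    then show ?case by (metis less_irrefl)
  qed
  have "((\<lambda>s. 1 / (e s * (2 + e s))) \<longlongrightarrow> 1 / (p * (2 + p))) at_top"
    using p_pos by (intro tendsto_intros lim_e[folded e_def]) auto
  also have "(\<lambda>s. 1 / (e s * (2 + e s))) = (\<lambda>s. 1 / phi F s / ?g' s)"
    by (intro ext) (simp add: e_def field_simps power2_eq_square)
  finally show "((\<lambda>s. 1 / phi F s / ?g' s) \<longlongrightarrow> 1 / (p * (2 + p))) at_top" .
qed simp

text \<open>The same computation one power higher: the quotient of the derivatives is \<open>2 / (e^2 (3 +
  e))\<close> with \<open>e = s \<phi> / \<Phi>\<close>.\<close>

lemma scaled_variance_asymptotics: "((\<lambda>s. scaled_variance v0 s / (s ^ 3 / Phi F s)) \<longlongrightarrow> 2 / (p ^ 2 * (3 + p))) at_top"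
proof (rule lhospital_at_top_at_top[OF power_over_Phi_at_top])
  define e where "e s = s * phi F s / Phi F s" for s
  let ?g' = "\<lambda>s. (3 * s ^ 2 * Phi F s + s ^ 3 * phi F s) / (Phi F s)\<^sup>2"
  show "\<forall>\<^sub>F s in at_top. (scaled_variance v0 has_real_derivative 2 * Phi F s / (phi F s)\<^sup>2) (at s)"
    using eventually_ge_at_top[of m0] by eventually_elim (rule DERIV_scaled_variance)
  show "\<forall>\<^sub>F s in at_top. ((\<lambda>s. s ^ 3 / Phi F s) has_real_derivative ?g' s) (at s)"
    by (intro always_eventually allI)
       (auto intro!: derivative_eq_intros DERIV_Phi simp: field_simps power2_eq_square)
  show "\<forall>\<^sub>F s in at_top. ?g' s \<noteq> 0"
    using eventually_gt_at_top[of 0]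
  proof eventually_elim
    case (elim s)
    then have "0 < ?g' s"
      by (intro divide_pos_pos add_pos_pos mult_pos_pos phi_pos Phi_pos zero_less_power) auto
    then show ?case by (metis less_irrefl)
  qed
  have "((\<lambda>s. 2 / (e s ^ 2 * (3 + e s))) \<longlongrightarrow> 2 / (p ^ 2 * (3 + p))) at_top"
    using p_pos by (intro tendsto_intros lim_e[folded e_def]) auto
  also have "\<forall>\<^sub>F s in at_top. 2 / (e s ^ 2 * (3 + e s)) = 2 * Phi F s / (phi F s)\<^sup>2 / ?g' s"
    using eventually_gt_at_top[of 0]
  proof eventually_elim
    case (elim s)
    define A where "A = 3 * Phi F s + s * phi F s"
    have A: "A \<noteq> 0"
      using elim phi_pos[of s] Phi_pos[of s] unfolding A_def by (metis add_pos_pos less_irrefl mult_pos_pos zero_less_numeral)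
    have g': "?g' s = s ^ 2 * A / (Phi F s)\<^sup>2"
      by (simp add: A_def power2_eq_square power3_eq_cube algebra_simps)
    have es: "e s ^ 2 * (3 + e s) = (s * phi F s)\<^sup>2 * A / (Phi F s) ^ 3"
      by (simp add: A_def e_def power2_eq_square power3_eq_cube field_simps)
    show ?case unfolding g' es using elim A
      by (simp add: power2_eq_square power3_eq_cube field_simps)
  qed
  then have "((\<lambda>s. 2 / (e s ^ 2 * (3 + e s))) \<longlongrightarrow> 2 / (p ^ 2 * (3 + p))) at_top
    = ((\<lambda>s. 2 * Phi F s / (phi F s)\<^sup>2 / ?g' s) \<longlongrightarrow> 2 / (p ^ 2 * (3 + p))) at_top"
    by (rule filterlim_cong[OF refl refl])
  finally show "((\<lambda>s. 2 * Phi F s / (phi F s)\<^sup>2 / ?g' s) \<longlongrightarrow> 2 / (p ^ 2 * (3 + p))) at_top" .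
qed simp

text \<open>The numerator is \<open>\<Psi>(\<mu>) \<phi>(\<mu>)\<close> because \<open>\<lambda> t =
  \<Psi>(\<mu>(t))\<close>, so the limit is \<open>p\<close> times the one found for \<open>\<Psi>(s) / (s^2 /
  \<Phi>(s))\<close>.\<close>

lemma log_derivative_\<mu>: "((\<lambda>t. t * (lam * phi F (\<mu> t)) / \<mu> t) \<longlongrightarrow> 1 / (p + 2)) at_top"
proof -
  have "((\<lambda>s. Psi_ext s / (s ^ 2 / Phi F s) * (s * phi F s / Phi F s)) \<longlongrightarrow> 1 / (p * (2 + p)) * p) at_top"
    by (intro tendsto_mult Psi_ext_asymptotics lim_e)
  also have "1 / (p * (2 + p)) * p = 1 / (p + 2)"
    using p_pos by simp
  finally have "((\<lambda>t. Psi_ext (\<mu> t) / (\<mu> t ^ 2 / Phi F (\<mu> t)) * (\<mu> t * phi F (\<mu> t) / Phi F (\<mu> t))) \<longlongrightarrow> 1 / (p + 2)) at_top"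
    by (rule filterlim_compose[OF _ \<mu>_at_top])
  moreover have "\<forall>\<^sub>F t in at_top. Psi_ext (\<mu> t) / (\<mu> t ^ 2 / Phi F (\<mu> t)) * (\<mu> t * phi F (\<mu> t) / Phi F (\<mu> t))
      = t * (lam * phi F (\<mu> t)) / \<mu> t"
    using eventually_ge_at_top[of 0] filterlim_at_top_dense[THEN iffD1, OF \<mu>_at_top, rule_format, of 0]
    by eventually_elim (simp add: Psi_ext_\<mu> power2_eq_square)
  ultimately show ?thesis by (simp add: filterlim_cong)
qed

lemmas \<mu>_ratio_tendsto =
  ratio_tendsto_powr_if_log_derivative[OF eventually_\<mu>_pos eventually_DERIV_\<mu> log_derivative_\<mu>]

lemmas ln_\<mu>_ratio_tendsto =
  ln_ratio_tendsto_if_log_derivative[OF eventually_\<mu>_pos eventually_DERIV_\<mu> log_derivative_\<mu>]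

lemma regularly_varying_\<mu>:
  assumes "0 \<le> m0"
  shows "regularly_varying \<mu> (1 / (p + 2))"
  unfolding regularly_varying_def
proof (intro conjI allI impI)
  have "(\<lambda>t. \<mu> (max t 0)) \<in> borel_measurable (restrict_space borel {0..})"
    by (intro measurable_restrict_space1 measurable_\<mu>_max)
  then show "\<mu> \<in> borel_measurable (restrict_space borel {0..})"
    by (rule measurable_cong[THEN iffD1, rotated]) (auto simp: space_restrict_space max_def)
  show "0 \<le> \<mu> t" if "0 \<le> t" for t using m0_le_\<mu>[OF that] assms by simp
qed (rule \<mu>_ratio_tendsto)

lemma variance_over_square_tendsto:
  "((\<lambda>t. phi F (\<mu> t) * scaled_variance v0 (\<mu> t) / (\<mu> t)\<^sup>2) \<longlongrightarrow> 2 / (p * (p + 3))) at_top"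
proof -
  have "((\<lambda>s. scaled_variance v0 s / (s ^ 3 / Phi F s) * (s * phi F s / Phi F s)) \<longlongrightarrow> 2 / (p ^ 2 * (3 + p)) * p) at_top"
    by (intro tendsto_mult scaled_variance_asymptotics lim_e)
  also have "2 / (p ^ 2 * (3 + p)) * p = 2 / (p * (p + 3))"
    using p_pos by (simp add: power2_eq_square add.commute)
  finally have "((\<lambda>s. scaled_variance v0 s / (s ^ 3 / Phi F s) * (s * phi F s / Phi F s)) \<longlongrightarrow> 2 / (p * (p + 3))) at_top" .
  moreover have "\<forall>\<^sub>F s in at_top. scaled_variance v0 s / (s ^ 3 / Phi F s) * (s * phi F s / Phi F s) = phi F s * scaled_variance v0 s / s\<^sup>2"
    using eventually_gt_at_top[of 0]
    by eventually_elim (simp add: power2_eq_square power3_eq_cube)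
  ultimately have "((\<lambda>s. phi F s * scaled_variance v0 s / s\<^sup>2) \<longlongrightarrow> 2 / (p * (p + 3))) at_top"
    by (simp add: filterlim_cong)
  then show ?thesis by (rule filterlim_compose[OF _ \<mu>_at_top])
qed

end

end


section \<open>Fair values\<close>

context offer_law
begin

lemma integrable_indicator [simp]: "A \<in> sets borel \<Longrightarrow> integrable F (\<lambda>x. indicator A x :: real)"
  by (rule integrable_const_bound[where B = 1]) (auto simp: indicator_def)

text \<open>Formally the integrand is \<open>- (\<phi> G)'\<close>, but \<open>\<phi>\<close> has a kink at
  each atom of \<open>F\<close>. For a single offer \<open>x\<close> the function \<open>(x - u)\<^sub>+
  G(u)\<close> has only one kink, where the fundamental theorem of calculus tolerates it; averaging over
  \<open>x\<close> with Fubini's theorem gives the identity for \<open>\<phi> G\<close>.\<close>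

lemma survival_by_parts:
  assumes "a \<le> b"
    and G: "\<And>u. a \<le> u \<Longrightarrow> u \<le> b \<Longrightarrow> (G has_real_derivative G' u) (at u)"
    and G': "continuous_on {a..b} G'"
  shows "(LBINT u:{a..b}. prob {u..} * G u - phi F u * G' u) = phi F a * G a - phi F b * G b"
    and "set_integrable lborel {a..b} (\<lambda>u. prob {u..} * G u - phi F u * G' u)"
proof -
  interpret L: pair_sigma_finite lborel F
    by (intro pair_sigma_finite.intro lborel.sigma_finite_measure_axioms sigma_finite_measure_axioms)
  have contG: "continuous_on {a..b} G"
    using G by (meson DERIV_atLeastAtMost_imp_continuous_on)
  define g where "g u = indicator {a..b} u * G u" for u
  define g' where "g' u = indicator {a..b} u * G' u" for u
  have int [simp]: "integrable lborel g" "integrable lborel g'"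
    unfolding g_def g'_def
    using borel_integrable_compact[OF compact_Icc contG] borel_integrable_compact[OF compact_Icc G'] by simp_all
  have [measurable]: "g \<in> borel_measurable borel" "g' \<in> borel_measurable borel"
    using int[THEN borel_measurable_integrable] by simp_all
  define f where "f u x = indicator {u..} x * g u - max (x - u) 0 * g' u" for u x
  have bound: "\<bar>f u x\<bar> \<le> \<bar>g u\<bar> + max (x - a) 0 * \<bar>g' u\<bar>" for u x
  proof -
    have "\<bar>max (x - u) 0 * g' u\<bar> \<le> max (x - a) 0 * \<bar>g' u\<bar>"
      unfolding abs_mult g'_def by (cases "u \<in> {a..b}") (auto intro!: mult_right_mono)
    moreover have "\<bar>indicator {u..} x * g u\<bar> \<le> \<bar>g u\<bar>" by (auto simp: indicator_def)
    ultimately show ?thesis unfolding f_def by linarith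
  qed
  have meas: "case_prod f \<in> borel_measurable (lborel \<Otimes>\<^sub>M F)"
  proof -
    have "{z \<in> space (borel \<Otimes>\<^sub>M borel). fst z \<le> (snd z :: real)} \<in> sets (borel \<Otimes>\<^sub>M borel)"
      by measurable
    then have [measurable]: "{z :: real \<times> real. fst z \<le> snd z} \<in> sets (borel \<Otimes>\<^sub>M borel)"
      by (simp add: space_pair_measure)
    have "case_prod f = (\<lambda>z. indicator {z. fst z \<le> snd z} z * g (fst z) - max (snd z - fst z) 0 * g' (fst z))"
      by (auto simp: f_def indicator_def)
    also have "\<dots> \<in> borel_measurable (lborel \<Otimes>\<^sub>M F)" by measurable
    finally show ?thesis .
  qed
  have "integrable (lborel \<Otimes>\<^sub>M F) (\<lambda>(u, x). \<bar>g u\<bar> + max (x - a) 0 * \<bar>g' u\<bar>)"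
  proof (rule L.Fubini_integrable)
    have "integrable lborel (\<lambda>u. \<bar>g u\<bar> + phi F a * \<bar>g' u\<bar>)" by simp
    then show "integrable lborel (\<lambda>u. \<integral>x. norm (case (u, x) of (u, x) \<Rightarrow> \<bar>g u\<bar> + max (x - a) 0 * \<bar>g' u\<bar>) \<partial>F)"
      using prob_space by (simp add: phi_eq_expectation abs_mult)
  qed auto
  then have int_f: "integrable (lborel \<Otimes>\<^sub>M F) (case_prod f)"
    by (rule Bochner_Integration.integrable_bound[OF _ meas]) (auto intro!: AE_I2 order_trans[OF bound])
  have inner: "(\<integral>u. f u x \<partial>lborel) = max (x - a) 0 * G a - max (x - b) 0 * G b" for x
  proof -
    let ?h = "\<lambda>u. indicator {u..} x * G u - max (x - u) 0 * G' u"
    have f_h: "f u x = indicator {a..b} u *\<^sub>R ?h u" for u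
      by (simp add: f_def g_def g'_def algebra_simps)
    have "integrable lborel (\<lambda>u. \<bar>g u\<bar> + max (x - a) 0 * \<bar>g' u\<bar>)" by simp
    then have "integrable lborel (\<lambda>u. f u x)"
      by (rule Bochner_Integration.integrable_bound) (use meas in \<open>auto intro!: AE_I2 order_trans[OF bound]\<close>)
    then have si: "set_integrable lborel {a..b} ?h"
      unfolding set_integrable_def f_h .
    have "(?h has_integral (- (max (x - b) 0 * G b) - - (max (x - a) 0 * G a))) {a..b}"
    proof (rule fundamental_theorem_of_calculus_strong[of "{x}" a b "\<lambda>u. - (max (x - u) 0 * G u)"])
      show "continuous_on {a..b} (\<lambda>u. - (max (x - u) 0 * G u))"
        by (intro continuous_intros contG)
      fix u assume u: "u \<in> {a..b} - {x}"
      then have DG: "(G has_real_derivative G' u) (at u)" using G by simp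
      show "((\<lambda>u. - (max (x - u) 0 * G u)) has_vector_derivative ?h u) (at u)"
      proof (cases "u < x")
        case True
        have "((\<lambda>u. - ((x - u) * G u)) has_real_derivative ?h u) (at u)"
          using True by (auto intro!: derivative_eq_intros DG)
        then have "((\<lambda>u. - (max (x - u) 0 * G u)) has_real_derivative ?h u) (at u)"
          by (rule has_field_derivative_transform_within_open[of _ _ _ "{..<x}"]) (use True in auto)
        then show ?thesis by (simp add: has_real_derivative_iff_has_vector_derivative)
      next
        case False
        then have "x < u" using u by simp
        have "((\<lambda>u. 0 :: real) has_real_derivative ?h u) (at u)"
          using \<open>x < u\<close> by simp
        then have "((\<lambda>u. - (max (x - u) 0 * G u)) has_real_derivative ?h u) (at u)"
          by (rule has_field_derivative_transform_within_open[of _ _ _ "{x<..}"]) (use \<open>x < u\<close> in auto)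
        then show ?thesis by (simp add: has_real_derivative_iff_has_vector_derivative)
      qed
    qed (use \<open>a \<le> b\<close> in auto)
    then have "integral {a..b} ?h = max (x - a) 0 * G a - max (x - b) 0 * G b"
      by (simp add: integral_unique)
    then show ?thesis
      using set_borel_integral_eq_integral(2)[OF si] by (simp add: f_h set_lebesgue_integral_def)
  qed
  have outer: "(\<integral>x. f u x \<partial>F) = indicator {a..b} u *\<^sub>R (prob {u..} * G u - phi F u * G' u)" for u
  proof -
    have "(\<integral>x. f u x \<partial>F) = prob {u..} * g u - phi F u * g' u"
      unfolding f_def phi_eq_expectation by (subst Bochner_Integration.integral_diff) auto
    then show ?thesis by (simp add: g_def g'_def algebra_simps)
  qed
  have "(\<integral>u. (\<integral>x. f u x \<partial>F) \<partial>lborel) = (\<integral>x. (\<integral>u. f u x \<partial>lborel) \<partial>F)"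
    by (rule L.Fubini_integral[OF int_f, symmetric])
  also have "\<dots> = phi F a * G a - phi F b * G b"
    unfolding inner phi_eq_expectation by simp
  finally show "(LBINT u:{a..b}. prob {u..} * G u - phi F u * G' u) = phi F a * G a - phi F b * G b"
    unfolding outer set_lebesgue_integral_def .
  show "set_integrable lborel {a..b} (\<lambda>u. prob {u..} * G u - phi F u * G' u)"
    using L.integrable_fst'[OF int_f] unfolding set_integrable_def by (simp add: outer)
qed

end

context optimal_selling
begin

text \<open>The mean value of an offer under the threshold \<open>u\<close>, if an accepted offer
  \<open>x\<close> is worth \<open>h x\<close> and a rejected one leaves the seller with \<open>W
  u\<close>.\<close>

definition offer_value :: "(real \<Rightarrow> real) \<Rightarrow> (real \<Rightarrow> real) \<Rightarrow> real \<Rightarrow> real" where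
  "offer_value h W u = (\<integral>x. (if u \<le> x then h x else W u) \<partial>F)"

text \<open>Integrated form of \<open>(exp \<Psi> W)' = exp \<Psi> \<sqdot> offer_value / \<phi>\<close>. With
  \<open>w(t) = W(\<mu>(t))\<close> this is the equation \<open>w' = \<lambda> (offer_value - w)\<close> in
  the price variable, multiplied by its integrating factor.\<close>

definition fair :: "(real \<Rightarrow> real) \<Rightarrow> (real \<Rightarrow> real) \<Rightarrow> bool" where
  "fair h W \<longleftrightarrow> (\<forall>b\<ge>m0.
     (LBINT u:{m0..b}. exp (Psi_ext u) * offer_value h W u / phi F u) = exp (Psi_ext b) * W b - W m0)"

lemma continuous_on_Psi_ext_Icc: "continuous_on {m0..b} Psi_ext"
  using continuous_on_Psi_ext by (rule continuous_on_subset) auto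

text \<open>The mean offer value is \<open>u + \<phi>(u)\<close>, and \<open>exp \<Psi> (u / \<phi> +
  1)\<close> is the derivative of \<open>exp \<Psi> u\<close>. Fairness for the identity is the optimality of
  the policy: the threshold equals the expected price.\<close>

lemma fair_identity: "fair (\<lambda>x. x) (\<lambda>u. u)"
  unfolding fair_def
proof (intro allI impI)
  fix b assume b: "m0 \<le> b"
  have ov: "offer_value (\<lambda>x. x) (\<lambda>u. u) u = u + phi F u" for u
  proof -
    have "offer_value (\<lambda>x. x) (\<lambda>u. u) u = (\<integral>x. u + max (x - u) 0 \<partial>F)"
      unfolding offer_value_def by (intro Bochner_Integration.integral_cong) auto
    then show ?thesis using prob_space by (simp add: phi_eq_expectation)
  qed
  have "(LBINT u:{m0..b}. exp (Psi_ext u) * (u + phi F u) / phi F u) = exp (Psi_ext b) * b - exp (Psi_ext m0) * m0"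
    unfolding set_lebesgue_integral_def
  proof (rule integral_FTC_atLeastAtMost[OF b])
    fix u assume "m0 \<le> u" "u \<le> b"
    then have "((\<lambda>u. exp (Psi_ext u) * u) has_real_derivative exp (Psi_ext u) * (u + phi F u) / phi F u) (at u)"
      by (auto intro!: derivative_eq_intros DERIV_Psi_ext simp: field_simps)
    then show "((\<lambda>u. exp (Psi_ext u) * u) has_vector_derivative exp (Psi_ext u) * (u + phi F u) / phi F u) (at u within {m0..b})"
      by (simp add: has_real_derivative_iff_has_vector_derivative has_vector_derivative_at_within)
  qed (intro continuous_intros continuous_on_Psi_ext_Icc continuous_on_phi; simp)
  then show "(LBINT u:{m0..b}. exp (Psi_ext u) * offer_value (\<lambda>x. x) (\<lambda>u. u) u / phi F u) = exp (Psi_ext b) * b - m0"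
    by (simp add: ov)
qed

text \<open>Below \<open>m0\<close> the factor is frozen at its value at \<open>m0\<close> to obtain a
  function that is continuous everywhere.\<close>

definition second_moment :: "real \<Rightarrow> real \<Rightarrow> real" where
  "second_moment v0 u = u\<^sup>2 + phi F u * scaled_variance v0 (max u m0)"

lemma continuous_on_scaled_variance: "continuous_on {m0..} (scaled_variance v0)"
  by (rule DERIV_continuous_on) (auto intro: DERIV_subset[OF DERIV_scaled_variance])

lemma continuous_on_second_moment: "continuous_on A (second_moment v0)"
proof -
  have "continuous_on A (\<lambda>u. scaled_variance v0 (max u m0))"
    by (rule continuous_on_compose2[OF continuous_on_scaled_variance]) (auto intro!: continuous_intros)
  then show ?thesis
    unfolding second_moment_def by (intro continuous_intros continuous_on_phi)
qed

text \<open>The integrand splits into \<open>(exp \<Psi> u^2)'\<close> and a remainder that formally is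
  \<open>(\<phi> G)'\<close> with \<open>G = exp \<Psi> K\<close>, where \<open>K\<close> is the scaled
  variance; the remainder is handled by parts.\<close>

lemma fair_square: "fair (\<lambda>x. x\<^sup>2) (second_moment v0)"
  unfolding fair_def
proof (intro allI impI)
  fix b assume b: "m0 \<le> b"
  let ?W = "second_moment v0"
  let ?G = "\<lambda>u. exp (Psi_ext u) * scaled_variance v0 u"
  let ?G' = "\<lambda>u. exp (Psi_ext u) * (scaled_variance v0 u / phi F u + 2 * Phi F u / (phi F u)\<^sup>2)"
  let ?R = "\<lambda>u. exp (Psi_ext u) * (u\<^sup>2 / phi F u + 2 * u)"
  have expansion: "(\<integral>x. w + 2 * u * max (x - u) 0 + (max (x - u) 0)\<^sup>2 - indicator {u..} x * c \<partial>F)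
      = w + 2 * u * phi F u + 2 * Phi F u - prob {u..} * c" for u w c
    using prob_space by (simp add: phi_eq_expectation Phi_eq_expectation)
  have ov: "offer_value (\<lambda>x. x\<^sup>2) ?W u = ?W u + 2 * u * phi F u + 2 * Phi F u - prob {u..} * (phi F u * scaled_variance v0 u)"
    if u: "m0 \<le> u" for u
  proof -
    have "offer_value (\<lambda>x. x\<^sup>2) ?W u
        = (\<integral>x. ?W u + 2 * u * max (x - u) 0 + (max (x - u) 0)\<^sup>2 - indicator {u..} x * (phi F u * scaled_variance v0 u) \<partial>F)"
      unfolding offer_value_def second_moment_def
      using u by (intro Bochner_Integration.integral_cong)
        (auto simp: max_def power2_eq_square algebra_simps indicator_def)
    also have "\<dots> = ?W u + 2 * u * phi F u + 2 * Phi F u - prob {u..} * (phi F u * scaled_variance v0 u)"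
      unfolding expansion ..
    finally show ?thesis .
  qed
  have contK: "continuous_on {m0..b} (scaled_variance v0)"
    using continuous_on_scaled_variance by (rule continuous_on_subset) auto
  have contR: "continuous_on {m0..b} ?R"
    by (intro continuous_intros continuous_on_Psi_ext_Icc continuous_on_phi) auto
  have R: "(LBINT u:{m0..b}. ?R u) = exp (Psi_ext b) * b\<^sup>2 - exp (Psi_ext m0) * m0\<^sup>2"
    unfolding set_lebesgue_integral_def
  proof (rule integral_FTC_atLeastAtMost[OF b _ contR])
    fix u assume "m0 \<le> u" "u \<le> b"
    then have "((\<lambda>u. exp (Psi_ext u) * u\<^sup>2) has_real_derivative ?R u) (at u)"
      by (auto intro!: derivative_eq_intros DERIV_Psi_ext simp: field_simps)
    then show "((\<lambda>u. exp (Psi_ext u) * u\<^sup>2) has_vector_derivative ?R u) (at u within {m0..b})"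
      by (simp add: has_real_derivative_iff_has_vector_derivative has_vector_derivative_at_within)
  qed
  have intR: "set_integrable lborel {m0..b} ?R"
    by (rule borel_integrable_atLeastAtMost'[OF contR])
  have DG: "(?G has_real_derivative ?G' u) (at u)" if "m0 \<le> u" "u \<le> b" for u
    using that by (auto intro!: derivative_eq_intros DERIV_Psi_ext DERIV_scaled_variance simp: algebra_simps)
  have contG': "continuous_on {m0..b} ?G'"
    by (intro continuous_intros continuous_on_Psi_ext_Icc continuous_on_phi continuous_on_Phi contK) auto
  note parts = survival_by_parts[OF b DG contG']
  have "(LBINT u:{m0..b}. exp (Psi_ext u) * offer_value (\<lambda>x. x\<^sup>2) ?W u / phi F u)
      = (LBINT u:{m0..b}. ?R u - (prob {u..} * ?G u - phi F u * ?G' u))"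
  proof (rule set_lebesgue_integral_cong)
    show "\<forall>u. u \<in> {m0..b} \<longrightarrow> exp (Psi_ext u) * offer_value (\<lambda>x. x\<^sup>2) ?W u / phi F u
        = ?R u - (prob {u..} * ?G u - phi F u * ?G' u)"
    proof (intro allI impI)
      fix u assume "u \<in> {m0..b}"
      then have u: "m0 \<le> u" "max u m0 = u" by auto
      show "exp (Psi_ext u) * offer_value (\<lambda>x. x\<^sup>2) ?W u / phi F u
          = ?R u - (prob {u..} * ?G u - phi F u * ?G' u)"
        unfolding ov[OF u(1)] second_moment_def u(2) by (simp add: field_simps power2_eq_square)
    qed
  qed simp
  also have "\<dots> = (LBINT u:{m0..b}. ?R u) - (LBINT u:{m0..b}. prob {u..} * ?G u - phi F u * ?G' u)"
    by (rule set_integral_diff(2)[OF intR parts(2)])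
  also have "\<dots> = (exp (Psi_ext b) * b\<^sup>2 - exp (Psi_ext m0) * m0\<^sup>2) - (phi F m0 * ?G m0 - phi F b * ?G b)"
    by (rule arg_cong2[where f = "(-)", OF R parts(1)])
  also have "\<dots> = exp (Psi_ext b) * ?W b - ?W m0"
    using b by (simp add: second_moment_def algebra_simps)
  finally show "(LBINT u:{m0..b}. exp (Psi_ext u) * offer_value (\<lambda>x. x\<^sup>2) ?W u / phi F u)
      = exp (Psi_ext b) * ?W b - ?W m0" .
qed

end

locale fair_value = optimal_selling F lam F0 for F lam F0 +
  fixes h W :: "real \<Rightarrow> real"
  assumes fair: "fair h W"
    and measurable_h [measurable]: "h \<in> borel_measurable borel"
    and continuous_W: "continuous_on UNIV W"
    and integrable_h: "integrable F (\<lambda>x. indicator {m0..} x * h x)"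
    and h_nonneg: "m0 \<le> x \<Longrightarrow> 0 \<le> h x"
    and W_nonneg: "m0 \<le> u \<Longrightarrow> 0 \<le> W u"
begin

lemma measurable_W [measurable]: "W \<in> borel_measurable borel"
  using continuous_W by (rule borel_measurable_continuous_onI)

lemma measurable_offer_value [measurable]: "offer_value h W \<in> borel_measurable borel"
  unfolding offer_value_def by measurable

lemma W_\<mu>_bounded:
  obtains B where "\<And>q. 0 \<le> q \<Longrightarrow> q \<le> r \<Longrightarrow> \<bar>W (\<mu> q)\<bar> \<le> B"
proof -
  have "compact (W ` {m0..\<mu> r})"
    by (intro compact_continuous_image continuous_on_subset[OF continuous_W]) auto
  then have "bounded (W ` {m0..\<mu> r})" by (rule compact_imp_bounded)
  then obtain B where B: "\<forall>y\<in>W ` {m0..\<mu> r}. norm y \<le> B"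
    unfolding bounded_iff by blast
  have "\<bar>W (\<mu> q)\<bar> \<le> B" if "0 \<le> q" "q \<le> r" for q
    using m0_le_\<mu>[OF that(1)] \<mu>_mono[OF that] B by simp
  then show thesis by (rule that)
qed

lemma offer_value_bound:
  assumes "m0 \<le> u"
  shows "\<bar>offer_value h W u\<bar> \<le> (\<integral>x. indicator {m0..} x * h x \<partial>F) + \<bar>W u\<bar>"
proof -
  have bound: "\<bar>if u \<le> x then h x else W u\<bar> \<le> indicator {m0..} x * h x + \<bar>W u\<bar>" for x
    using assms h_nonneg[of x] by (auto simp: indicator_def)
  have "integrable F (\<lambda>x. if u \<le> x then h x else W u)"
  proof (rule Bochner_Integration.integrable_bound)
    show "integrable F (\<lambda>x. indicator {m0..} x * h x + \<bar>W u\<bar>)" using integrable_h by simp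
    show "AE x in F. norm (if u \<le> x then h x else W u) \<le> norm (indicator {m0..} x * h x + \<bar>W u\<bar>)"
      by (intro AE_I2) (metis bound abs_ge_self order_trans real_norm_def)
  qed measurable
  then have "\<bar>offer_value h W u\<bar> \<le> (\<integral>x. indicator {m0..} x * h x + \<bar>W u\<bar> \<partial>F)"
    unfolding offer_value_def
    by (intro order_trans[OF integral_abs_bound] integral_mono bound) (auto simp: integrable_h)
  then show ?thesis using integrable_h prob_space by simp
qed

text \<open>With \<open>r\<close> time units left, the seller waits an exponential time \<open>d\<close>, then
  accepts or rejects, or else meets the deadline. In the variable \<open>u = \<mu>(r - d)\<close> the density
  of the waiting time becomes \<open>exp (\<Psi>(u) - \<Psi>(\<mu>(r))) / \<phi>(u)\<close>, which turns the
  expectation into the integral of the fairness identity.\<close>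

lemma one_step:
  assumes r: "0 \<le> r"
  shows "(\<integral>d. exponential_density lam d *
      (\<integral>x. (if 0 < r - d \<and> \<mu> (r - d) \<le> x then h x else W (\<mu> (max (r - d) 0))) \<partial>F) \<partial>lborel) = W (\<mu> r)"
proof -
  define b where "b = \<mu> r"
  have b: "m0 \<le> b" "Psi_ext b = lam * r" using m0_le_\<mu>[OF r] Psi_ext_\<mu>[OF r] by (simp_all add: b_def)
  \<comment> \<open>Subtracting the value at the deadline confines the integrand to \<open>d < r\<close>.\<close>
  define Y where "Y u = offer_value h W u - W m0" for u
  have [measurable]: "Y \<in> borel_measurable borel" unfolding Y_def by measurable
  obtain B where B: "\<And>q. 0 \<le> q \<Longrightarrow> q \<le> r \<Longrightarrow> \<bar>W (\<mu> q)\<bar> \<le> B"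
    using W_\<mu>_bounded[of r] by blast
  obtain C where C: "\<And>q. 0 \<le> q \<Longrightarrow> q \<le> r \<Longrightarrow> \<bar>Y (\<mu> q)\<bar> \<le> C"
  proof
    fix q assume q: "0 \<le> q" "q \<le> r"
    show "\<bar>Y (\<mu> q)\<bar> \<le> (\<integral>x. indicator {m0..} x * h x \<partial>F) + B + \<bar>W m0\<bar>"
      unfolding Y_def using offer_value_bound[OF m0_le_\<mu>[OF q(1)]] B[OF q] by linarith
  qed
  let ?f = "\<lambda>q. lam * exp (- (lam * r)) * exp (lam * q) * Y (\<mu> (max q 0))"
  let ?J = "\<lambda>d. \<integral>x. (if 0 < r - d \<and> \<mu> (r - d) \<le> x then h x else W (\<mu> (max (r - d) 0))) \<partial>F"
  interpret E: prob_space "density lborel (exponential_density lam)"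
    by (rule prob_space_exponential_density[OF lam_pos])
  have exp_int: "integrable lborel (exponential_density lam)" "(\<integral>d. exponential_density lam d \<partial>lborel) = 1"
    using E.integrable_const[of "1 :: real"] E.prob_space
      integrable_density[of "\<lambda>_. 1 :: real" lborel "exponential_density lam"]
      integral_density[of "\<lambda>_. 1 :: real" lborel "exponential_density lam"]
    by (simp_all add: exponential_density_nonneg[OF lam_pos])
  have J: "exponential_density lam d * ?J d = W m0 * exponential_density lam d
      + exponential_density lam d * (indicator {0..<r} d * Y (\<mu> (max (r - d) 0)))" for d
  proof (cases "0 \<le> d \<and> d < r")
    case True
    then have "?J d = offer_value h W (\<mu> (r - d))"
      unfolding offer_value_def by (intro Bochner_Integration.integral_cong) auto
    then show ?thesis using True by (simp add: Y_def algebra_simps)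
  next
    case False
    then consider "d < 0" | "r \<le> d" by linarith
    then show ?thesis
    proof cases
      case 1
      then show ?thesis by (simp add: exponential_density_def)
    next
      case 2
      then show ?thesis using prob_space by simp
    qed
  qed
  have intY: "integrable lborel (\<lambda>d. exponential_density lam d * (indicator {0..<r} d * Y (\<mu> (max (r - d) 0))))"
  proof (rule Bochner_Integration.integrable_bound)
    show "integrable lborel (\<lambda>d. C * exponential_density lam d)" using exp_int by simp
    show "AE d in lborel. norm (exponential_density lam d * (indicator {0..<r} d * Y (\<mu> (max (r - d) 0))))
        \<le> norm (C * exponential_density lam d)"
    proof (intro AE_I2)
      fix d
      show "norm (exponential_density lam d * (indicator {0..<r} d * Y (\<mu> (max (r - d) 0))))
        \<le> norm (C * exponential_density lam d)"
        using C[of "r - d"] exponential_density_nonneg[OF lam_pos, of d]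
          mult_left_mono[of "\<bar>Y (\<mu> (r - d))\<bar>" C "exponential_density lam d"]
        by (auto simp: abs_mult indicator_def mult.commute[of C])
    qed
  qed measurable
  have f_int: "set_integrable lborel {0..r} ?f"
    unfolding set_integrable_def
  proof (rule Bochner_Integration.integrable_bound)
    let ?C = "lam * exp (- (lam * r)) * exp (lam * r) * C"
    show "integrable lborel (\<lambda>q. ?C * indicator {0..r} q)"
      by (intro integrable_mult_right) (simp add: integrable_indicator_iff r)
    have "norm (indicator {0..r} q *\<^sub>R ?f q) \<le> norm (?C * indicator {0..r} q)" for q
    proof (cases "q \<in> {0..r}")
      case True
      then have "\<bar>?f q\<bar> \<le> ?C"
        using lam_pos C[of q] by (simp add: abs_mult mult_mono)
      then show ?thesis using True abs_ge_self[of ?C] by simp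
    qed simp
    then show "AE q in lborel. norm (indicator {0..r} q *\<^sub>R ?f q) \<le> norm (?C * indicator {0..r} q)"
      by (intro AE_I2)
  qed measurable
  have f_int': "set_integrable lborel {Psi_ext m0 / lam..Psi_ext b / lam} ?f"
    using f_int b lam_pos by simp
  have DQ: "((\<lambda>u. Psi_ext u / lam) has_real_derivative 1 / phi F u / lam) (at u)" if "u \<in> {m0..b}" for u
    using that lam_pos by (auto intro!: derivative_eq_intros DERIV_Psi_ext)
  have cont_DQ: "continuous_on {m0..b} (\<lambda>u. 1 / phi F u / lam)"
    using lam_pos by (intro continuous_intros continuous_inverse_phi) auto
  have DQ_nonneg: "0 \<le> 1 / phi F u / lam" for u
    using lam_pos phi_nonneg[of u] by simp
  note sub = integral_substitution[OF f_int' DQ cont_DQ DQ_nonneg b(1)]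
  have pull_back: "?f (Psi_ext u / lam) * (1 / phi F u / lam) = exp (- (lam * r)) * (exp (Psi_ext u) * Y u / phi F u)"
    if u: "m0 \<le> u" for u
  proof -
    have "0 \<le> Psi_ext u" using Psi_ext_le_iff[of m0 u] u by simp
    moreover have "\<mu> (Psi_ext u / lam) = u" using u lam_pos by (intro \<mu>_eqI) auto
    moreover have "max (Psi_ext u / lam) 0 = Psi_ext u / lam"
      using \<open>0 \<le> Psi_ext u\<close> lam_pos by (intro max_absorb1) simp
    ultimately show ?thesis using lam_pos by simp
  qed
  have "(\<integral>d. exponential_density lam d * ?J d \<partial>lborel)
      = W m0 + (\<integral>d. exponential_density lam d * (indicator {0..<r} d * Y (\<mu> (max (r - d) 0))) \<partial>lborel)"
    unfolding J using exp_int intY by simp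
  also have "(\<integral>d. exponential_density lam d * (indicator {0..<r} d * Y (\<mu> (max (r - d) 0))) \<partial>lborel)
      = (\<integral>q. exponential_density lam (r - q) * (indicator {0..<r} (r - q) * Y (\<mu> (max q 0))) \<partial>lborel)"
    by (subst lborel_integral_real_affine[where c = "-1" and t = r]) auto
  also have "\<dots> = (\<integral>q. ?f q * indicator {0..r} q \<partial>lborel)"
  proof (rule integral_cong_AE)
    show "AE q in lborel. exponential_density lam (r - q) * (indicator {0..<r} (r - q) * Y (\<mu> (max q 0)))
        = ?f q * indicator {0..r} q"
      using AE_lborel_singleton[of 0]
      by eventually_elim (auto simp: exponential_density_def indicator_def algebra_simps exp_add[symmetric])
  qed measurable
  also have "\<dots> = (\<integral>u. ?f (Psi_ext u / lam) * (1 / phi F u / lam) * indicator {m0..b} u \<partial>lborel)"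
    using sub(2) Psi_ext_m0 b lam_pos by simp
  also have "\<dots> = (\<integral>u. exp (- (lam * r)) * (indicator {m0..b} u *\<^sub>R (exp (Psi_ext u) * Y u / phi F u)) \<partial>lborel)"
  proof (rule Bochner_Integration.integral_cong[OF refl])
    fix u
    show "?f (Psi_ext u / lam) * (1 / phi F u / lam) * indicator {m0..b} u
        = exp (- (lam * r)) * (indicator {m0..b} u *\<^sub>R (exp (Psi_ext u) * Y u / phi F u))"
    proof (cases "u \<in> {m0..b}")
      case True
      then have "m0 \<le> u" by simp
      show ?thesis unfolding pull_back[OF \<open>m0 \<le> u\<close>] using True by simp
    qed simp
  qed
  also have "\<dots> = exp (- (lam * r)) * (LBINT u:{m0..b}. exp (Psi_ext u) * Y u / phi F u)"
    unfolding set_lebesgue_integral_def by (rule integral_mult_right_zero)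
  also have "(LBINT u:{m0..b}. exp (Psi_ext u) * Y u / phi F u) = exp (Psi_ext b) * W b - W m0 - W m0 * (exp (Psi_ext b) - 1)"
  proof -
    have "set_integrable lborel {m0..b} (\<lambda>u. exp (- (lam * r)) * (exp (Psi_ext u) * Y u / phi F u))"
      using sub(1)
      by (rule set_integrable_cong[OF refl refl, THEN iffD1, rotated -1]) (assumption | rule pull_back, simp)+
    then have i1: "set_integrable lborel {m0..b} (\<lambda>u. exp (Psi_ext u) * Y u / phi F u)"
      by (rule set_integrable_mult_right_iff[THEN iffD1, rotated]) simp
    have cont: "continuous_on {m0..b} (\<lambda>u. W m0 * (exp (Psi_ext u) / phi F u))"
      by (intro continuous_intros continuous_on_Psi_ext_Icc continuous_on_phi) auto
    have i2: "set_integrable lborel {m0..b} (\<lambda>u. W m0 * (exp (Psi_ext u) / phi F u))"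
      by (rule borel_integrable_atLeastAtMost'[OF cont])
    have e2: "(LBINT u:{m0..b}. W m0 * (exp (Psi_ext u) / phi F u)) = W m0 * exp (Psi_ext b) - W m0 * exp (Psi_ext m0)"
      unfolding set_lebesgue_integral_def
    proof (rule integral_FTC_atLeastAtMost[OF b(1) _ cont])
      fix u assume "m0 \<le> u" "u \<le> b"
      then have "((\<lambda>u. W m0 * exp (Psi_ext u)) has_real_derivative W m0 * (exp (Psi_ext u) / phi F u)) (at u)"
        by (auto intro!: derivative_eq_intros DERIV_Psi_ext)
      then show "((\<lambda>u. W m0 * exp (Psi_ext u)) has_vector_derivative W m0 * (exp (Psi_ext u) / phi F u)) (at u within {m0..b})"
        by (simp add: has_real_derivative_iff_has_vector_derivative has_vector_derivative_at_within)
    qed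
    have "(LBINT u:{m0..b}. exp (Psi_ext u) * Y u / phi F u + W m0 * (exp (Psi_ext u) / phi F u))
        = (LBINT u:{m0..b}. exp (Psi_ext u) * offer_value h W u / phi F u)"
      by (simp add: Y_def diff_divide_distrib algebra_simps)
    also have "\<dots> = exp (Psi_ext b) * W b - W m0"
      using fair b(1) unfolding fair_def by blast
    finally show ?thesis
      using set_integral_add(2)[OF i1 i2] e2 by (simp add: algebra_simps)
  qed
  also have "W m0 + exp (- (lam * r)) * \<dots> = W (\<mu> r)"
    unfolding b(2) b_def[symmetric] by (simp add: algebra_simps exp_minus)
  finally show ?thesis .
qed

end

section \<open>The bidding process\<close>

lemma remaining_time_cong:
  "(\<And>i. 1 \<le> i \<Longrightarrow> i \<le> n \<Longrightarrow> D i \<omega> = D' i \<omega>') \<Longrightarrow> remaining_time D t \<omega> n = remaining_time D' t \<omega>' n"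
  by (induction n) auto

lemma measurable_remaining_time:
  "(\<And>i. 1 \<le> i \<Longrightarrow> i \<le> n \<Longrightarrow> D i \<in> borel_measurable M) \<Longrightarrow>
    (\<lambda>\<omega>. remaining_time D t \<omega> n) \<in> borel_measurable M"
  by (induction n) auto

lemma remaining_time_nonneg: "0 \<le> t \<Longrightarrow> 0 \<le> remaining_time D t \<omega> n"
  by (induction n) auto

locale sale_process = optimal_selling F lam F0 + P: prob_space P
  for F lam F0 and P :: "'a measure" +
  fixes D X :: "nat \<Rightarrow> 'a \<Rightarrow> real" and t :: real
  assumes indep: "P.indep_vars (\<lambda>_. borel) (case_sum D X) ({1..} <+> UNIV)"
    and D_exponential: "1 \<le> i \<Longrightarrow> distributed P lborel (D i) (exponential_density lam)"
    and distr_X: "1 \<le> i \<Longrightarrow> distr P borel (X i) = F"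
    and distr_X0: "distr P borel (X 0) = F0"
    and t_nonneg: "0 \<le> t"
begin

abbreviation "T n \<omega> \<equiv> remaining_time D t \<omega> n"
abbreviation "acc n \<omega> \<equiv> accepted \<mu> D X t \<omega> n"

definition unsold :: "nat \<Rightarrow> 'a \<Rightarrow> real" where
  "unsold n \<omega> = of_bool (\<forall>i\<le>n. \<not> acc i \<omega>)"

lemma T_nonneg: "0 \<le> T n \<omega>"
  by (rule remaining_time_nonneg[OF t_nonneg])

lemma measurable_X [measurable]: "X i \<in> borel_measurable P"
  using indep unfolding P.indep_vars_def by force

lemma measurable_D: "1 \<le> i \<Longrightarrow> D i \<in> borel_measurable P"
  using indep unfolding P.indep_vars_def by force

lemma measurable_D_Suc [measurable]: "D (Suc i) \<in> borel_measurable P"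
  by (rule measurable_D) simp

lemma measurable_T [measurable]: "(\<lambda>\<omega>. T n \<omega>) \<in> borel_measurable P"
  by (intro measurable_remaining_time measurable_D)

lemma accepted_cong:
  assumes "\<And>i. 1 \<le> i \<Longrightarrow> i \<le> n \<Longrightarrow> D i \<omega> = D' i \<omega>'" "\<And>i. 1 \<le> i \<Longrightarrow> i \<le> n \<Longrightarrow> X i \<omega> = X' i \<omega>'"
  shows "accepted \<mu> D X t \<omega> n \<longleftrightarrow> accepted \<mu> D' X' t \<omega>' n"
  unfolding accepted_def
  using remaining_time_cong[of n D \<omega> D' \<omega>' t] assms by auto

lemma measurable_accepted:
  fixes D' X' :: "nat \<Rightarrow> 'b \<Rightarrow> real"
  assumes "\<And>i. 1 \<le> i \<Longrightarrow> i \<le> n \<Longrightarrow> D' i \<in> borel_measurable M" "1 \<le> n \<Longrightarrow> X' n \<in> borel_measurable M"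
  shows "Measurable.pred M (\<lambda>\<omega>. accepted \<mu> D' X' t \<omega> n)"
proof (cases "1 \<le> n")
  case True
  have [measurable]: "(\<lambda>\<omega>. remaining_time D' t \<omega> n) \<in> borel_measurable M" "X' n \<in> borel_measurable M"
    using assms True by (auto intro: measurable_remaining_time)
  have "(\<lambda>\<omega>. accepted \<mu> D' X' t \<omega> n)
      = (\<lambda>\<omega>. 0 < remaining_time D' t \<omega> n \<and> \<mu> (max (remaining_time D' t \<omega> n) 0) \<le> X' n \<omega>)"
    using True by (auto simp: accepted_def max_def fun_eq_iff)
  then show ?thesis by simp
qed (simp add: accepted_def)

lemma measurable_acc [measurable]: "Measurable.pred P (acc n)"
  by (intro measurable_accepted measurable_D measurable_X)

lemma measurable_unsold [measurable]: "unsold n \<in> borel_measurable P"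
  unfolding unsold_def[abs_def] of_bool_def by measurable

text \<open>Indices of the first \<open>n\<close> waiting times (left summand) and offers (right summand) in
  the independent family of the model. The residual price, with index \<open>Inr 0\<close>, is left
  out.\<close>

definition history :: "nat \<Rightarrow> (nat + nat) set" where
  "history n = Inl ` {1..n} \<union> Inr ` {1..n}"

lemma state_eq_function_of_history:
  obtains Y :: "(nat + nat \<Rightarrow> real) \<Rightarrow> real \<times> real"
  where "Y \<in> measurable (PiM (history n) (\<lambda>_. borel)) (borel \<Otimes>\<^sub>M borel)"
    and "\<And>\<omega>. Y (restrict (\<lambda>i. case_sum D X i \<omega>) (history n)) = (unsold n \<omega>, T n \<omega>)"
proof
  let ?D = "\<lambda>i (y :: nat + nat \<Rightarrow> real). y (Inl i)" and ?X = "\<lambda>i (y :: nat + nat \<Rightarrow> real). y (Inr i)"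
  let ?M = "PiM (history n) (\<lambda>_. borel) :: (nat + nat \<Rightarrow> real) measure"
  let ?Y = "\<lambda>y. (of_bool (\<forall>i\<le>n. \<not> accepted \<mu> ?D ?X t y i) :: real, remaining_time ?D t y n)"
  have D: "?D i \<in> borel_measurable ?M" and X: "?X i \<in> borel_measurable ?M" if "1 \<le> i" "i \<le> n" for i
    using that by (auto simp: history_def intro!: measurable_component_singleton)
  have [measurable]: "Measurable.pred ?M (\<lambda>y. accepted \<mu> ?D ?X t y i)" if "i \<le> n" for i
    using that by (intro measurable_accepted D X) auto
  have "(\<lambda>y. of_bool (\<forall>i\<le>n. \<not> accepted \<mu> ?D ?X t y i) :: real) \<in> borel_measurable ?M"
    unfolding of_bool_def by measurable
  then show "?Y \<in> measurable ?M (borel \<Otimes>\<^sub>M borel)"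
    by (intro measurable_Pair measurable_remaining_time D)
  fix \<omega>
  let ?y = "restrict (\<lambda>i. case_sum D X i \<omega>) (history n)"
  have "accepted \<mu> ?D ?X t ?y i \<longleftrightarrow> acc i \<omega>" if "i \<le> n" for i
    by (rule accepted_cong[symmetric]) (use that in \<open>auto simp: history_def\<close>)
  moreover have "remaining_time ?D t ?y n = T n \<omega>"
    by (rule remaining_time_cong) (auto simp: history_def)
  ultimately show "?Y ?y = (unsold n \<omega>, T n \<omega>)"
    by (auto simp: unsold_def)
qed

text \<open>The state is computed from the history alone, and the next waiting time and offer have indices
  outside it.\<close>

lemma indep_state_next:
  "P.indep_var (borel \<Otimes>\<^sub>M borel) (\<lambda>\<omega>. (unsold n \<omega>, T n \<omega>))
     (borel \<Otimes>\<^sub>M borel) (\<lambda>\<omega>. (D (Suc n) \<omega>, X (Suc n) \<omega>))"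
proof -
  obtain Y where Y: "Y \<in> measurable (PiM (history n) (\<lambda>_. borel)) (borel \<Otimes>\<^sub>M borel)"
    "\<And>\<omega>. Y (restrict (\<lambda>i. case_sum D X i \<omega>) (history n)) = (unsold n \<omega>, T n \<omega>)"
    using state_eq_function_of_history[of n] by blast
  let ?next = "{Inl (Suc n), Inr (Suc n)} :: (nat + nat) set"
  let ?Z = "\<lambda>y :: nat + nat \<Rightarrow> real. (y (Inl (Suc n)), y (Inr (Suc n)))"
  have "P.indep_var (PiM (history n) (\<lambda>_. borel)) (\<lambda>\<omega>. restrict (\<lambda>i. case_sum D X i \<omega>) (history n))
      (PiM ?next (\<lambda>_. borel)) (\<lambda>\<omega>. restrict (\<lambda>i. case_sum D X i \<omega>) ?next)"
    by (rule P.indep_var_restrict[OF indep]) (auto simp: history_def)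
  from P.indep_var_compose[OF this Y(1), of ?Z "borel \<Otimes>\<^sub>M borel"] show ?thesis
    by (simp add: comp_def Y(2))
qed

lemma indep_unsold_X0: "P.indep_var borel (unsold n) borel (X 0)"
proof -
  obtain Y where Y: "Y \<in> measurable (PiM (history n) (\<lambda>_. borel)) (borel \<Otimes>\<^sub>M borel)"
    "\<And>\<omega>. Y (restrict (\<lambda>i. case_sum D X i \<omega>) (history n)) = (unsold n \<omega>, T n \<omega>)"
    using state_eq_function_of_history[of n] by blast
  have "P.indep_var (PiM (history n) (\<lambda>_. borel)) (\<lambda>\<omega>. restrict (\<lambda>i. case_sum D X i \<omega>) (history n))
      (PiM {Inr 0} (\<lambda>_. borel)) (\<lambda>\<omega>. restrict (\<lambda>i. case_sum D X i \<omega>) {Inr 0})"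
    by (rule P.indep_var_restrict[OF indep]) (auto simp: history_def)
  from P.indep_var_compose[OF this measurable_compose[OF Y(1) measurable_fst], of "\<lambda>y. y (Inr 0)" borel]
  show ?thesis by (simp add: comp_def Y(2))
qed

lemma indep_D_X:
  assumes "1 \<le> i"
  shows "P.indep_var borel (D i) borel (X i)"
proof -
  have "P.indep_var (PiM {Inl i} (\<lambda>_. borel)) (\<lambda>\<omega>. restrict (\<lambda>i. case_sum D X i \<omega>) {Inl i})
      (PiM {Inr i} (\<lambda>_. borel)) (\<lambda>\<omega>. restrict (\<lambda>i. case_sum D X i \<omega>) {Inr i})"
    by (rule P.indep_var_restrict[OF indep]) (use assms in auto)
  from P.indep_var_compose[OF this, of "\<lambda>y. y (Inl i)" borel "\<lambda>y. y (Inr i)" borel]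
  show ?thesis by (simp add: comp_def)
qed

lemma AE_D_nonneg: "AE \<omega> in P. \<forall>i\<ge>1. 0 \<le> D i \<omega>"
proof -
  have "AE \<omega> in P. 1 \<le> i \<longrightarrow> 0 \<le> D i \<omega>" for i
  proof (cases "1 \<le> i")
    case True
    have "P.prob {\<omega> \<in> space P. D i \<omega> \<le> 0} = 0"
      using P.exponential_distributedD_le[OF D_exponential[OF True], of 0] lam_pos by simp
    then have "AE \<omega> in P. \<not> D i \<omega> \<le> 0"
      using measurable_D[OF True] by (subst (asm) P.prob_Collect_eq_0) auto
    then show ?thesis by eventually_elim simp
  qed simp
  then have "\<forall>i. AE \<omega> in P. 1 \<le> i \<longrightarrow> 0 \<le> D i \<omega>" ..
  then show ?thesis unfolding AE_all_countable[symmetric] .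
qed

lemma T_le: "(\<And>i. 1 \<le> i \<Longrightarrow> 0 \<le> D i \<omega>) \<Longrightarrow> T n \<omega> \<le> t"
proof (induction n)
  case (Suc n)
  have "0 \<le> D (Suc n) \<omega>" by (rule Suc.prems) simp
  moreover have "T n \<omega> \<le> t" using Suc by blast
  ultimately show ?case using t_nonneg by simp
qed simp

lemma AE_T_le: "AE \<omega> in P. \<forall>n. T n \<omega> \<le> t"
  using AE_D_nonneg by eventually_elim (auto intro: T_le)

text \<open>A single waiting time longer than \<open>t\<close> ends the marketing period, and by independence
  the first \<open>n\<close> waiting times all avoid this with probability \<open>(1 - exp (- t * lam)) ^
  n\<close>.\<close>

lemma AE_eventually_T_0: "AE \<omega> in P. \<exists>N. \<forall>n\<ge>N. T n \<omega> = 0"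
proof -
  define q where "q = 1 - exp (- t * lam)"
  have q: "0 \<le> q" "q < 1" using t_nonneg lam_pos by (auto simp: q_def)
  let ?A = "{\<omega> \<in> space P. \<forall>i. D (Suc i) \<omega> \<le> t}"
  have "P.prob ?A \<le> q ^ Suc n" for n
  proof -
    let ?J = "Inl ` {1..Suc n} :: (nat + nat) set"
    have "P.prob ?A \<le> P.prob (\<Inter>j\<in>?J. case_sum D X j -` {..t} \<inter> space P)"
    proof (rule P.finite_measure_mono)
      show "?A \<subseteq> (\<Inter>j\<in>?J. case_sum D X j -` {..t} \<inter> space P)"
      proof clarsimp
        fix \<omega> i assume "\<forall>i. D (Suc i) \<omega> \<le> t" "Suc 0 \<le> i"
        then show "D i \<omega> \<le> t" by (metis Suc_le_D)
      qed
      have "(case_sum D X j -` {..t} \<inter> space P) \<in> sets P" if "j \<in> ?J" for j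
        using that by (auto intro!: measurable_sets[OF measurable_D])
      then show "(\<Inter>j\<in>?J. case_sum D X j -` {..t} \<inter> space P) \<in> sets P"
        by (intro sets.finite_INT) auto
    qed
    also have "\<dots> = (\<Prod>j\<in>?J. P.prob (case_sum D X j -` {..t} \<inter> space P))"
      by (rule P.indep_varsD[OF indep]) auto
    also have "\<dots> = (\<Prod>i\<in>{1..Suc n}. P.prob (D i -` {..t} \<inter> space P))"
      by (subst prod.reindex) auto
    also have "\<dots> = (\<Prod>i\<in>{1..Suc n}. q)"
    proof (rule prod.cong[OF refl])
      fix i assume "i \<in> {1..Suc n}"
      then have "P.prob {\<omega> \<in> space P. D i \<omega> \<le> t} = q"
        using P.exponential_distributedD_le[OF D_exponential[of i] t_nonneg lam_pos] by (simp add: q_def)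
      moreover have "{\<omega> \<in> space P. D i \<omega> \<le> t} = D i -` {..t} \<inter> space P" by auto
      ultimately show "P.prob (D i -` {..t} \<inter> space P) = q" by simp
    qed
    finally show ?thesis by simp
  qed
  moreover have "(\<lambda>n. q ^ Suc n) \<longlonglongrightarrow> 0"
    using LIMSEQ_realpow_zero[OF q] by (rule LIMSEQ_Suc)
  ultimately have "P.prob ?A \<le> 0"
    by (intro LIMSEQ_le_const) auto
  then have "P.prob ?A = 0" by (simp add: measure_le_0_iff)
  then have "AE \<omega> in P. \<not> (\<forall>i. D (Suc i) \<omega> \<le> t)"
    by (subst (asm) P.prob_Collect_eq_0) auto
  then show ?thesis
    using AE_D_nonneg
  proof eventually_elim
    case (elim \<omega>)
    then obtain i where i: "t < D (Suc i) \<omega>" by (auto simp: not_le)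
    have "T n \<omega> = 0" if "Suc i \<le> n" for n
      using that
    proof (induction n rule: dec_induct)
      case base
      show ?case using T_le[of \<omega> i] elim i by simp
    next
      case (step n)
      then show ?case using elim(2) by simp
    qed
    then show ?case by blast
  qed
qed

end

locale fair_sale_process = sale_process F lam F0 P D X t + fair_value F lam F0 h W
  for F lam F0 and P :: "'a measure" and D X t h W +
  assumes integrable_h_F0: "integrable F0 h"
    and h_F0: "(\<integral>x. h x \<partial>F0) = W m0"
begin

text \<open>The worth of the next waiting time \<open>d\<close> and offer \<open>x\<close> when
  \<open>r\<close> time units are left. The policy is only used at nonnegative times, where it is monotone and
  hence measurable.\<close>

definition next_value :: "real \<Rightarrow> real \<Rightarrow> real \<Rightarrow> real" where
  "next_value r d x = (if 0 < r - d \<and> \<mu> (max (r - d) 0) \<le> x then h x else W (\<mu> (max (r - d) 0)))"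

lemma measurable_W_\<mu> [measurable]: "(\<lambda>r. W (\<mu> (max r 0))) \<in> borel_measurable borel"
  by measurable

lemma measurable_next_value [measurable (raw)]:
  assumes "r \<in> borel_measurable M" "d \<in> borel_measurable M" "x \<in> borel_measurable M"
  shows "(\<lambda>z. next_value (r z) (d z) (x z)) \<in> borel_measurable M"
proof -
  note assms [measurable]
  show ?thesis unfolding next_value_def by measurable
qed

lemma integrable_h_X:
  assumes "1 \<le> i"
  shows "integrable P (\<lambda>\<omega>. indicator {m0..} (X i \<omega>) * h (X i \<omega>))"
proof -
  have "integrable (distr P borel (X i)) (\<lambda>x. indicator {m0..} x * h x)"
    using integrable_h distr_X[OF assms] by simp
  then show ?thesis by (subst (asm) integrable_distr_eq) auto
qed

lemma integrable_h_X0: "integrable P (\<lambda>\<omega>. h (X 0 \<omega>))"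
  using integrable_h_F0 unfolding distr_X0[symmetric] by (subst (asm) integrable_distr_eq) auto

lemma expectation_h_X0: "(\<integral>\<omega>. h (X 0 \<omega>) \<partial>P) = W m0"
  using h_F0 unfolding distr_X0[symmetric] by (subst (asm) integral_distr) auto

lemma integrable_next_value:
  assumes [measurable]: "R \<in> borel_measurable P" and R: "AE \<omega> in P. 0 \<le> R \<omega> \<and> R \<omega> \<le> c" and i: "1 \<le> i"
  shows "integrable P (\<lambda>\<omega>. next_value (R \<omega>) (D i \<omega>) (X i \<omega>))"
proof -
  obtain B where B: "\<And>q. 0 \<le> q \<Longrightarrow> q \<le> c \<Longrightarrow> \<bar>W (\<mu> q)\<bar> \<le> B"
    using W_\<mu>_bounded[of c] by blast
  note measurable_D[OF i, measurable]
  show ?thesis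
  proof (rule Bochner_Integration.integrable_bound)
    show "integrable P (\<lambda>\<omega>. indicator {m0..} (X i \<omega>) * h (X i \<omega>) + \<bar>B\<bar>)"
      using integrable_h_X[OF i] by simp
    show "AE \<omega> in P. norm (next_value (R \<omega>) (D i \<omega>) (X i \<omega>)) \<le> norm (indicator {m0..} (X i \<omega>) * h (X i \<omega>) + \<bar>B\<bar>)"
      using R AE_D_nonneg
    proof eventually_elim
      case (elim \<omega>)
      then have D: "0 \<le> D i \<omega>" using i by blast
      let ?q = "max (R \<omega> - D i \<omega>) 0"
      have q: "m0 \<le> \<mu> ?q" "\<bar>W (\<mu> ?q)\<bar> \<le> B"
        using elim D by (auto intro!: m0_le_\<mu> B)
      have nn: "0 \<le> indicator {m0..} (X i \<omega>) * h (X i \<omega>)"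
        using h_nonneg[of "X i \<omega>"] by (simp add: indicator_def)
      show ?case
      proof (cases "0 < R \<omega> - D i \<omega> \<and> \<mu> ?q \<le> X i \<omega>")
        case True
        then have "m0 \<le> X i \<omega>" using q(1) by (meson order_trans)
        moreover have "next_value (R \<omega>) (D i \<omega>) (X i \<omega>) = h (X i \<omega>)"
          unfolding next_value_def by (rule if_P[OF True])
        ultimately show ?thesis using h_nonneg[of "X i \<omega>"] by simp
      next
        case False
        then have "next_value (R \<omega>) (D i \<omega>) (X i \<omega>) = W (\<mu> ?q)" by (auto simp: next_value_def)
        then show ?thesis using q nn by simp
      qed
    qed
  qed measurable
qed

lemma expectation_next_value_fixed:
  assumes r: "0 \<le> r" and i: "1 \<le> i"
  shows "(\<integral>\<omega>. next_value r (D i \<omega>) (X i \<omega>) \<partial>P) = W (\<mu> r)"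
proof -
  let ?E = "density lborel (exponential_density lam)"
  note measurable_D[OF i, measurable]
  interpret E: prob_space ?E by (rule prob_space_exponential_density[OF lam_pos])
  interpret EF: pair_prob_space ?E F ..
  have distr_D: "distr P borel (D i) = ?E"
    using D_exponential[OF i] by (simp add: distributed_def distr_def[of _ lborel] distr_def[of _ borel])
  have joint: "distr P (borel \<Otimes>\<^sub>M borel) (\<lambda>\<omega>. (D i \<omega>, X i \<omega>)) = ?E \<Otimes>\<^sub>M F"
    using indep_D_X[OF i] unfolding P.indep_var_distribution_eq by (simp add: distr_D distr_X[OF i])
  have "integrable P (\<lambda>\<omega>. next_value r (D i \<omega>) (X i \<omega>))"
    by (rule integrable_next_value[of "\<lambda>_. r" r, OF _ _ i]) (use r in auto)
  then have int: "integrable (?E \<Otimes>\<^sub>M F) (\<lambda>(d, x). next_value r d x)"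
    unfolding joint[symmetric] by (subst integrable_distr_eq) (auto simp: split_beta')
  have "(\<integral>\<omega>. next_value r (D i \<omega>) (X i \<omega>) \<partial>P) = (\<integral>z. (\<lambda>(d, x). next_value r d x) z \<partial>(?E \<Otimes>\<^sub>M F))"
    unfolding joint[symmetric] by (subst integral_distr) (auto simp: split_beta')
  also have "\<dots> = (\<integral>d. (\<integral>x. next_value r d x \<partial>F) \<partial>?E)"
    using EF.integral_fst'[OF int] by simp
  also have "\<dots> = (\<integral>d. exponential_density lam d * (\<integral>x. next_value r d x \<partial>F) \<partial>lborel)"
    by (subst integral_density) (auto simp: exponential_density_nonneg[OF lam_pos])
  also have "\<dots> = (\<integral>d. exponential_density lam d *
      (\<integral>x. (if 0 < r - d \<and> \<mu> (r - d) \<le> x then h x else W (\<mu> (max (r - d) 0))) \<partial>F) \<partial>lborel)"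
    by (intro Bochner_Integration.integral_cong arg_cong2[where f = "(*)"]) (auto simp: next_value_def max_def)
  also have "\<dots> = W (\<mu> r)" by (rule one_step[OF r])
  finally show ?thesis .
qed

lemma integrable_unsold_mult:
  assumes "integrable P f"
  shows "integrable P (\<lambda>\<omega>. unsold n \<omega> * f \<omega>)"
  using assms
proof (rule Bochner_Integration.integrable_bound)
  show "(\<lambda>\<omega>. unsold n \<omega> * f \<omega>) \<in> borel_measurable P"
    using borel_measurable_integrable[OF assms] by measurable
  show "AE \<omega> in P. norm (unsold n \<omega> * f \<omega>) \<le> norm (f \<omega>)"
    by (intro AE_I2) (simp add: unsold_def)
qed

lemma integrable_W_T: "integrable P (\<lambda>\<omega>. W (\<mu> (T n \<omega>)))"
proof -
  obtain B where B: "\<And>q. 0 \<le> q \<Longrightarrow> q \<le> t \<Longrightarrow> \<bar>W (\<mu> q)\<bar> \<le> B"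
    using W_\<mu>_bounded[of t] by blast
  have "integrable P (\<lambda>\<omega>. W (\<mu> (max (T n \<omega>) 0)))"
  proof (rule P.integrable_const_bound)
    show "AE \<omega> in P. norm (W (\<mu> (max (T n \<omega>) 0))) \<le> B"
      using AE_T_le by eventually_elim (use T_nonneg in \<open>simp add: max_absorb1 B\<close>)
  qed measurable
  then show ?thesis by (simp add: max_absorb1 T_nonneg)
qed

text \<open>The next waiting time and offer are independent of the state, so the one-step identity may be
  applied with the state held fixed.\<close>

lemma expectation_next_value:
  "(\<integral>\<omega>. unsold n \<omega> * next_value (T n \<omega>) (D (Suc n) \<omega>) (X (Suc n) \<omega>) \<partial>P)
    = (\<integral>\<omega>. unsold n \<omega> * W (\<mu> (T n \<omega>)) \<partial>P)"
proof -
  let ?S = "distr P (borel \<Otimes>\<^sub>M borel) (\<lambda>\<omega>. (unsold n \<omega>, T n \<omega>))"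
  let ?N = "distr P (borel \<Otimes>\<^sub>M borel) (\<lambda>\<omega>. (D (Suc n) \<omega>, X (Suc n) \<omega>))"
  let ?g = "\<lambda>z :: (real \<times> real) \<times> (real \<times> real). fst (fst z) * next_value (max (snd (fst z)) 0) (fst (snd z)) (snd (snd z))"
  interpret S: prob_space ?S by (rule P.prob_space_distr) measurable
  interpret N: prob_space ?N by (rule P.prob_space_distr) measurable
  interpret SN: pair_prob_space ?S ?N ..
  have joint: "distr P ((borel \<Otimes>\<^sub>M borel) \<Otimes>\<^sub>M (borel \<Otimes>\<^sub>M borel))
      (\<lambda>\<omega>. ((unsold n \<omega>, T n \<omega>), (D (Suc n) \<omega>, X (Suc n) \<omega>))) = ?S \<Otimes>\<^sub>M ?N"
    using indep_state_next[of n] unfolding P.indep_var_distribution_eq by simp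
  have "integrable P (\<lambda>\<omega>. unsold n \<omega> * next_value (T n \<omega>) (D (Suc n) \<omega>) (X (Suc n) \<omega>))"
    by (intro integrable_unsold_mult integrable_next_value[of _ t]) (use AE_T_le T_nonneg in auto)
  then have int: "integrable (?S \<Otimes>\<^sub>M ?N) ?g"
    unfolding joint[symmetric]
    by (subst integrable_distr_eq) (simp_all add: max_absorb1 T_nonneg)
  have "(\<integral>\<omega>. unsold n \<omega> * next_value (T n \<omega>) (D (Suc n) \<omega>) (X (Suc n) \<omega>) \<partial>P) = (\<integral>z. ?g z \<partial>(?S \<Otimes>\<^sub>M ?N))"
    unfolding joint[symmetric]
    by (subst integral_distr) (simp_all add: max_absorb1 T_nonneg)
  also have "\<dots> = (\<integral>s. (\<integral>y. ?g (s, y) \<partial>?N) \<partial>?S)"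
    by (rule SN.integral_fst'[OF int, symmetric])
  also have "\<dots> = (\<integral>s. fst s * W (\<mu> (max (snd s) 0)) \<partial>?S)"
  proof (rule Bochner_Integration.integral_cong[OF refl])
    fix s :: "real \<times> real"
    have "(\<integral>y. ?g (s, y) \<partial>?N) = fst s * (\<integral>\<omega>. next_value (max (snd s) 0) (D (Suc n) \<omega>) (X (Suc n) \<omega>) \<partial>P)"
      by (subst integral_distr) simp_all
    then show "(\<integral>y. ?g (s, y) \<partial>?N) = fst s * W (\<mu> (max (snd s) 0))"
      using expectation_next_value_fixed[of "max (snd s) 0" "Suc n"] by simp
  qed
  also have "\<dots> = (\<integral>\<omega>. unsold n \<omega> * W (\<mu> (T n \<omega>)) \<partial>P)"
    by (subst integral_distr) (simp_all add: max_absorb1 T_nonneg)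
  finally show ?thesis .
qed

text \<open>At most one summand is nonzero, the one of the accepted offer; the sum form makes the increments
  accessible one at a time.\<close>

definition proceeds :: "nat \<Rightarrow> 'a \<Rightarrow> real" where
  "proceeds n \<omega> = (\<Sum>i<n. unsold i \<omega> * of_bool (acc (Suc i) \<omega>) * h (X (Suc i) \<omega>))"

lemma unsold_Suc: "unsold (Suc n) \<omega> = unsold n \<omega> * of_bool (\<not> acc (Suc n) \<omega>)"
  by (auto simp: unsold_def le_Suc_eq)

lemma unsold_0 [simp]: "unsold 0 \<omega> = 1"
  by (simp add: unsold_def accepted_def)

lemma acc_Suc_iff:
  "acc (Suc n) \<omega> \<longleftrightarrow> 0 < T n \<omega> - D (Suc n) \<omega> \<and> \<mu> (max (T n \<omega> - D (Suc n) \<omega>) 0) \<le> X (Suc n) \<omega>"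
  by (auto simp: accepted_def)

lemma acc_imp_m0_le: "acc n \<omega> \<Longrightarrow> m0 \<le> X n \<omega>"
  using m0_le_\<mu>[OF T_nonneg[of \<omega> n]] by (auto simp: accepted_def)

lemma next_value_eq:
  "unsold n \<omega> * next_value (T n \<omega>) (D (Suc n) \<omega>) (X (Suc n) \<omega>)
    = unsold n \<omega> * of_bool (acc (Suc n) \<omega>) * h (X (Suc n) \<omega>) + unsold (Suc n) \<omega> * W (\<mu> (T (Suc n) \<omega>))"
  unfolding unsold_Suc next_value_def acc_Suc_iff[symmetric] by simp

lemma integrable_increment: "integrable P (\<lambda>\<omega>. unsold n \<omega> * of_bool (acc (Suc n) \<omega>) * h (X (Suc n) \<omega>))"
proof (rule Bochner_Integration.integrable_bound)
  show "integrable P (\<lambda>\<omega>. indicator {m0..} (X (Suc n) \<omega>) * h (X (Suc n) \<omega>))"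
    by (rule integrable_h_X) simp
  show "AE \<omega> in P. norm (unsold n \<omega> * of_bool (acc (Suc n) \<omega>) * h (X (Suc n) \<omega>))
      \<le> norm (indicator {m0..} (X (Suc n) \<omega>) * h (X (Suc n) \<omega>))"
    by (intro AE_I2) (auto simp: unsold_def dest: acc_imp_m0_le)
  show "(\<lambda>\<omega>. unsold n \<omega> * of_bool (acc (Suc n) \<omega>) * h (X (Suc n) \<omega>)) \<in> borel_measurable P"
    unfolding of_bool_def by measurable
qed

lemma integrable_proceeds: "integrable P (proceeds n)"
  unfolding proceeds_def[abs_def] by (intro Bochner_Integration.integrable_sum integrable_increment)

text \<open>The collected payoff plus the current holding is a martingale: a sale moves the item from the
  second term to the first, and the mean change is zero by the one-step identity.\<close>

lemma expectation_proceeds: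
  "(\<integral>\<omega>. proceeds n \<omega> \<partial>P) + (\<integral>\<omega>. unsold n \<omega> * W (\<mu> (T n \<omega>)) \<partial>P) = W (\<mu> t)"
proof (induction n)
  case 0
  show ?case using P.prob_space by (simp add: proceeds_def)
next
  case (Suc n)
  have "(\<integral>\<omega>. unsold n \<omega> * W (\<mu> (T n \<omega>)) \<partial>P)
      = (\<integral>\<omega>. unsold n \<omega> * of_bool (acc (Suc n) \<omega>) * h (X (Suc n) \<omega>) + unsold (Suc n) \<omega> * W (\<mu> (T (Suc n) \<omega>)) \<partial>P)"
    unfolding expectation_next_value[symmetric] next_value_eq ..
  also have "\<dots> = (\<integral>\<omega>. unsold n \<omega> * of_bool (acc (Suc n) \<omega>) * h (X (Suc n) \<omega>) \<partial>P)
      + (\<integral>\<omega>. unsold (Suc n) \<omega> * W (\<mu> (T (Suc n) \<omega>)) \<partial>P)"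
    by (intro Bochner_Integration.integral_add integrable_increment integrable_unsold_mult integrable_W_T)
  finally have "(\<integral>\<omega>. unsold n \<omega> * W (\<mu> (T n \<omega>)) \<partial>P) = \<dots>" .
  moreover have "proceeds (Suc n) \<omega>
      = proceeds n \<omega> + unsold n \<omega> * of_bool (acc (Suc n) \<omega>) * h (X (Suc n) \<omega>)" for \<omega>
    by (simp add: proceeds_def)
  then have "(\<integral>\<omega>. proceeds (Suc n) \<omega> \<partial>P)
      = (\<integral>\<omega>. proceeds n \<omega> \<partial>P) + (\<integral>\<omega>. unsold n \<omega> * of_bool (acc (Suc n) \<omega>) * h (X (Suc n) \<omega>) \<partial>P)"
    using Bochner_Integration.integral_add[OF integrable_proceeds[of n] integrable_increment[of n]]
    by simp
  ultimately show ?case using Suc by simp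
qed

text \<open>The free value \<open>c\<close> of an unsold item serves twice: \<open>c = 0\<close> isolates the
  proceeds, and \<open>c = h (X 0)\<close> yields the payoff of the sale price itself.\<close>

lemma proceeds_plus_unsold:
  "proceeds n \<omega> + unsold n \<omega> * c = (if \<exists>i\<le>n. acc i \<omega> then h (X (LEAST i. acc i \<omega>) \<omega>) else c)"
proof (induction n arbitrary: c)
  case 0
  have "\<not> acc 0 \<omega>" by (simp add: accepted_def)
  then show ?case by (simp add: proceeds_def)
next
  case (Suc n)
  show ?case
  proof (cases "\<exists>i\<le>n. acc i \<omega>")
    case True
    then have "unsold n \<omega> = 0" by (auto simp: unsold_def)
    moreover have "\<exists>i\<le>Suc n. acc i \<omega>" using True le_SucI by blast
    ultimately show ?thesis using Suc[of c] True by (simp add: proceeds_def unsold_Suc)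
  next
    case False
    then have u: "unsold n \<omega> = 1" by (auto simp: unsold_def)
    then have p: "proceeds n \<omega> = 0" using Suc[of 0] False by simp
    show ?thesis
    proof (cases "acc (Suc n) \<omega>")
      case True
      have "(LEAST i. acc i \<omega>) = Suc n"
      proof (rule Least_equality)
        show "acc (Suc n) \<omega>" by (rule True)
        fix i assume "acc i \<omega>"
        then show "Suc n \<le> i" using False by (meson not_less_eq_eq)
      qed
      moreover have "\<exists>i\<le>Suc n. acc i \<omega>" using True by blast
      ultimately show ?thesis using u p True by (simp add: proceeds_def unsold_Suc)
    next
      case no: False
      then have none: "\<not> (\<exists>i\<le>Suc n. acc i \<omega>)" using False by (auto simp: le_Suc_eq)
      show ?thesis unfolding if_not_P[OF none] using u p no by (simp add: proceeds_def unsold_Suc)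
    qed
  qed
qed

lemma measurable_sale_price [measurable]: "sale_price \<mu> D X t \<in> borel_measurable P"
proof -
  have [measurable]: "(\<lambda>\<omega>. LEAST i. acc i \<omega>) \<in> measurable P (count_space UNIV)"
    by (rule measurable_Least) measurable
  have [measurable]: "(\<lambda>\<omega>. X (LEAST i. acc i \<omega>) \<omega>) \<in> borel_measurable P"
    by (rule measurable_compose_countable[OF measurable_X]) measurable
  show ?thesis unfolding sale_price_def[abs_def] by measurable
qed

lemma proceeds_mono: "m \<le> n \<Longrightarrow> proceeds m \<omega> \<le> proceeds n \<omega>"
  unfolding proceeds_def using h_nonneg acc_imp_m0_le
  by (intro sum_mono2) (auto simp: unsold_def)

text \<open>Let the number of offers tend to infinity in the martingale identity. The proceeds increase and
  their means are bounded by \<open>W(\<mu>(t))\<close>, so their limit is integrable and dominates; the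
  holding \<open>W(\<mu>(T n))\<close> tends to \<open>W m0\<close>, which is the mean payoff of the
  independent residual price.\<close>

lemma
  shows integrable_h_sale_price: "integrable P (\<lambda>\<omega>. h (sale_price \<mu> D X t \<omega>))"
    and expectation_h_sale_price: "(\<integral>\<omega>. h (sale_price \<mu> D X t \<omega>) \<partial>P) = W (\<mu> t)"
proof -
  let ?A = "\<lambda>\<omega>. \<exists>i. acc i \<omega>"
  define L where "L \<omega> = of_bool (?A \<omega>) * h (sale_price \<mu> D X t \<omega>)" for \<omega>
  let ?Y = "\<lambda>n \<omega>. proceeds n \<omega> + unsold n \<omega> * h (X 0 \<omega>)"
  have [measurable]: "L \<in> borel_measurable P"
    unfolding L_def[abs_def] of_bool_def by measurable
  have final: "AE \<omega> in P. \<exists>N. \<forall>n\<ge>N. T n \<omega> = 0 \<and>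
      (\<forall>c. proceeds n \<omega> + unsold n \<omega> * c = (if ?A \<omega> then h (sale_price \<mu> D X t \<omega>) else c))"
    using AE_eventually_T_0
  proof eventually_elim
    case (elim \<omega>)
    then obtain N where N: "\<And>n. N \<le> n \<Longrightarrow> T n \<omega> = 0" by blast
    have "i < N" if "acc i \<omega>" for i
      using N[of i] that by (cases "i < N") (auto simp: accepted_def)
    then have *: "(\<exists>i\<le>n. acc i \<omega>) \<longleftrightarrow> ?A \<omega>" if "N \<le> n" for n
      using that by (meson less_imp_le less_le_trans)
    have "proceeds n \<omega> + unsold n \<omega> * c = (if ?A \<omega> then h (sale_price \<mu> D X t \<omega>) else c)"
      if "N \<le> n" for n c
      unfolding proceeds_plus_unsold *[OF that] sale_price_def
      by (cases "?A \<omega>") (simp_all only: if_True if_False)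
    then show ?case using N by blast
  qed
  have lim_L: "AE \<omega> in P. (\<lambda>n. proceeds n \<omega>) \<longlonglongrightarrow> L \<omega>"
    using final
  proof eventually_elim
    case (elim \<omega>)
    then obtain N where N: "\<And>n c. N \<le> n \<Longrightarrow>
        proceeds n \<omega> + unsold n \<omega> * c = (if ?A \<omega> then h (sale_price \<mu> D X t \<omega>) else c)" by blast
    have "proceeds n \<omega> = L \<omega>" if "N \<le> n" for n
      using N[OF that, of 0] by (simp add: L_def)
    then show ?case
      by (intro tendsto_eventually) (auto simp: eventually_sequentially)
  qed
  have lim_Y: "AE \<omega> in P. (\<lambda>n. ?Y n \<omega>) \<longlonglongrightarrow> h (sale_price \<mu> D X t \<omega>)"
    using final
  proof eventually_elim
    case (elim \<omega>)
    then obtain N where N: "\<And>n c. N \<le> n \<Longrightarrow>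
        proceeds n \<omega> + unsold n \<omega> * c = (if ?A \<omega> then h (sale_price \<mu> D X t \<omega>) else c)" by blast
    have "?Y n \<omega> = h (sale_price \<mu> D X t \<omega>)" if "N \<le> n" for n
      using N[OF that, of "h (X 0 \<omega>)"] by (simp add: sale_price_def)
    then show ?case
      by (intro tendsto_eventually) (auto simp: eventually_sequentially)
  qed
  have lim_W: "AE \<omega> in P. (\<lambda>n. unsold n \<omega> * (W m0 - W (\<mu> (T n \<omega>)))) \<longlonglongrightarrow> 0"
    using AE_eventually_T_0
  proof eventually_elim
    case (elim \<omega>)
    then obtain N where "\<And>n. N \<le> n \<Longrightarrow> T n \<omega> = 0" by blast
    then show ?case by (intro tendsto_eventually eventually_sequentiallyI[of N]) simp
  qed
  have "(\<integral>\<omega>. proceeds n \<omega> \<partial>P) \<le> W (\<mu> t)" for n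
  proof -
    have "0 \<le> (\<integral>\<omega>. unsold n \<omega> * W (\<mu> (T n \<omega>)) \<partial>P)"
      by (intro Bochner_Integration.integral_nonneg mult_nonneg_nonneg W_nonneg m0_le_\<mu> T_nonneg) (simp add: unsold_def)
    then show ?thesis using expectation_proceeds[of n] by linarith
  qed
  moreover have "incseq (\<lambda>n. \<integral>\<omega>. proceeds n \<omega> \<partial>P)"
    by (intro incseq_SucI integral_mono integrable_proceeds proceeds_mono) simp
  ultimately obtain l where "(\<lambda>n. \<integral>\<omega>. proceeds n \<omega> \<partial>P) \<longlonglongrightarrow> l"
    using incseq_convergent[of "\<lambda>n. \<integral>\<omega>. proceeds n \<omega> \<partial>P" "W (\<mu> t)"] by blast
  then have int_L: "integrable P L"
    using lim_L by (intro integrable_monotone_convergence[of P proceeds L]) (auto intro!: integrable_proceeds monoI proceeds_mono)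
  have int_Y: "integrable P (?Y n)" for n
    by (intro Bochner_Integration.integrable_add integrable_proceeds integrable_unsold_mult integrable_h_X0)
  have dom: "AE \<omega> in P. norm (?Y n \<omega>) \<le> L \<omega> + \<bar>h (X 0 \<omega>)\<bar>" for n
    using lim_L
  proof eventually_elim
    case (elim \<omega>)
    have "proceeds n \<omega> \<le> L \<omega>"
      by (rule incseq_le[OF _ elim]) (auto intro!: monoI proceeds_mono)
    moreover have "0 \<le> proceeds n \<omega>"
      using proceeds_mono[of 0 n \<omega>] by (simp add: proceeds_def)
    moreover have "\<bar>unsold n \<omega> * h (X 0 \<omega>)\<bar> \<le> \<bar>h (X 0 \<omega>)\<bar>" by (simp add: unsold_def)
    ultimately show ?case by simp
  qed
  have int_dom: "integrable P (\<lambda>\<omega>. L \<omega> + \<bar>h (X 0 \<omega>)\<bar>)"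
    using int_L integrable_h_X0 by simp
  show int_h: "integrable P (\<lambda>\<omega>. h (sale_price \<mu> D X t \<omega>))"
    by (rule integrable_dominated_convergence[OF _ _ int_dom lim_Y dom])
       (use int_Y[THEN borel_measurable_integrable] in measurable)
  have lim1: "(\<lambda>n. \<integral>\<omega>. ?Y n \<omega> \<partial>P) \<longlonglongrightarrow> (\<integral>\<omega>. h (sale_price \<mu> D X t \<omega>) \<partial>P)"
    by (rule integral_dominated_convergence[OF _ _ int_dom lim_Y dom])
       (use int_Y[THEN borel_measurable_integrable] in measurable)
  \<comment> \<open>The term that separates the mean of the stopped payoff from \<open>W(\<mu>(t))\<close> lives on the event that the item is unsold while time remains, and vanishes in the limit.\<close>
  have EY: "(\<integral>\<omega>. ?Y n \<omega> \<partial>P) = W (\<mu> t) + (\<integral>\<omega>. unsold n \<omega> * (W m0 - W (\<mu> (T n \<omega>))) \<partial>P)" for n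
  proof -
    have iu: "integrable P (unsold n)"
      using integrable_unsold_mult[of "\<lambda>_. 1" n] by simp
    have "(\<integral>\<omega>. unsold n \<omega> * h (X 0 \<omega>) \<partial>P) = (\<integral>\<omega>. unsold n \<omega> \<partial>P) * (\<integral>\<omega>. h (X 0 \<omega>) \<partial>P)"
    proof (rule P.indep_var_lebesgue_integral[OF _ iu integrable_h_X0])
      show "P.indep_var borel (unsold n) borel (\<lambda>\<omega>. h (X 0 \<omega>))"
        using P.indep_var_compose[OF indep_unsold_X0[of n], of "\<lambda>x. x" borel h borel] by (simp add: comp_def)
    qed
    then have "(\<integral>\<omega>. ?Y n \<omega> \<partial>P) = (\<integral>\<omega>. proceeds n \<omega> \<partial>P) + (\<integral>\<omega>. unsold n \<omega> \<partial>P) * W m0"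
      using Bochner_Integration.integral_add[OF integrable_proceeds[of n] integrable_unsold_mult[OF integrable_h_X0, of n]]
      by (simp add: expectation_h_X0)
    moreover have "(\<integral>\<omega>. unsold n \<omega> * (W m0 - W (\<mu> (T n \<omega>))) \<partial>P)
        = (\<integral>\<omega>. unsold n \<omega> \<partial>P) * W m0 - (\<integral>\<omega>. unsold n \<omega> * W (\<mu> (T n \<omega>)) \<partial>P)"
      using Bochner_Integration.integral_diff[OF integrable_mult_left[OF iu, of "W m0"] integrable_unsold_mult[OF integrable_W_T[of n], of n]]
      by (simp add: right_diff_distrib)
    ultimately show ?thesis using expectation_proceeds[of n] by linarith
  qed
  obtain B where B: "\<And>q. 0 \<le> q \<Longrightarrow> q \<le> t \<Longrightarrow> \<bar>W (\<mu> q)\<bar> \<le> B"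
    using W_\<mu>_bounded[of t] by blast
  have "(\<lambda>n. \<integral>\<omega>. unsold n \<omega> * (W m0 - W (\<mu> (T n \<omega>))) \<partial>P) \<longlonglongrightarrow> (\<integral>\<omega>. 0 \<partial>P)"
  proof (rule integral_dominated_convergence[OF _ _ _ lim_W, of "\<lambda>_. \<bar>W m0\<bar> + B"])
    show "AE \<omega> in P. norm (unsold n \<omega> * (W m0 - W (\<mu> (T n \<omega>)))) \<le> \<bar>W m0\<bar> + B" for n
      using AE_T_le
    proof eventually_elim
      case (elim \<omega>)
      then have "\<bar>W (\<mu> (T n \<omega>))\<bar> \<le> B" using B T_nonneg by blast
      then show ?case by (auto simp: unsold_def)
    qed
    show "(\<lambda>\<omega>. unsold n \<omega> * (W m0 - W (\<mu> (T n \<omega>)))) \<in> borel_measurable P" for n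
      using borel_measurable_integrable[OF integrable_W_T[of n]] by measurable
  qed auto
  then have "(\<lambda>n. \<integral>\<omega>. ?Y n \<omega> \<partial>P) \<longlonglongrightarrow> W (\<mu> t) + 0"
    unfolding EY by (intro tendsto_intros) simp
  with lim1 show "(\<integral>\<omega>. h (sale_price \<mu> D X t \<omega>) \<partial>P) = W (\<mu> t)"
    using LIMSEQ_unique by fastforce
qed

end

section \<open>The variance of the sale price\<close>

lemma (in offer_law) integrable_square_above:
  assumes "0 \<le> a"
  shows "integrable F (\<lambda>x. indicator {a..} x * x\<^sup>2)"
proof (rule Bochner_Integration.integrable_bound)
  show "integrable F (\<lambda>x. 2 * (max (x - a) 0)\<^sup>2 + 2 * a\<^sup>2)" by simp
  have "indicator {a..} x * x\<^sup>2 \<le> 2 * (max (x - a) 0)\<^sup>2 + 2 * a\<^sup>2" for x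
  proof (cases "a \<le> x")
    case True
    have "x\<^sup>2 \<le> 2 * (x - a)\<^sup>2 + 2 * a\<^sup>2"
      using zero_le_power2[of "x - 2 * a"] by (simp add: power2_eq_square algebra_simps)
    then show ?thesis using True by simp
  qed simp
  then show "AE x in F. norm (indicator {a..} x * x\<^sup>2) \<le> norm (2 * (max (x - a) 0)\<^sup>2 + 2 * a\<^sup>2)"
    by (intro AE_I2) simp
qed measurable

text \<open>Both moments come from fair pairs; in their difference the square of the threshold
  cancels.\<close>

lemma (in sale_process) variance_sale_price:
  fixes v0
  assumes F0: "real_distribution F0" and int: "integrable F0 (\<lambda>x. x)" and int2: "integrable F0 (\<lambda>x. x\<^sup>2)"
    and m0: "0 \<le> m0" and v0: "v0 = (\<integral>x. x\<^sup>2 \<partial>F0) - m0\<^sup>2"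
  shows "P.variance (sale_price \<mu> D X t) = phi F (\<mu> t) * scaled_variance v0 (\<mu> t)"
proof -
  interpret F0: real_distribution F0 by fact
  have v0_nonneg: "0 \<le> v0"
    using F0.variance_positive[of "\<lambda>x. x"] F0.variance_eq[OF int int2] by (simp add: v0 residual_mean_def)
  interpret M: fair_sale_process F lam F0 P D X t "\<lambda>x. x" "\<lambda>u. u"
  proof unfold_locales
    show "integrable F (\<lambda>x. indicator {m0..} x * x)"
    proof (rule Bochner_Integration.integrable_bound[OF integrable_pos_part])
      show "AE x in F. norm (indicator {m0..} x * x) \<le> norm (max x 0)"
        using m0 by (intro AE_I2) (auto simp: indicator_def)
    qed measurable
    show "(\<integral>x. x \<partial>F0) = m0"
      by (simp add: residual_mean_def)
  qed (rule fair_identity int | use m0 in simp)+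
  interpret S: fair_sale_process F lam F0 P D X t "\<lambda>x. x\<^sup>2" "second_moment v0"
  proof unfold_locales
    show "0 \<le> second_moment v0 u" if "m0 \<le> u" for u
      using that scaled_variance_nonneg[OF _ v0_nonneg, of u] phi_nonneg by (simp add: second_moment_def)
    show "(\<integral>x. x\<^sup>2 \<partial>F0) = second_moment v0 m0"
      by (simp add: second_moment_def v0)
  qed (rule fair_square continuous_on_second_moment integrable_square_above[OF m0] int2 | simp)+
  have "P.variance (sale_price \<mu> D X t) = second_moment v0 (\<mu> t) - (\<mu> t)\<^sup>2"
    using P.variance_eq[OF M.integrable_h_sale_price S.integrable_h_sale_price]
    by (simp add: M.expectation_h_sale_price S.expectation_h_sale_price)
  then show ?thesis
    using m0_le_\<mu>[OF t_nonneg] by (simp add: second_moment_def max_absorb1)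
qed

lemma (in optimal_selling) measurable_variance_formula:
  "(\<lambda>t. phi F (\<mu> (max t 0)) * scaled_variance v0 (max (\<mu> (max t 0)) m0)) \<in> borel_measurable borel"
proof -
  have "continuous_on UNIV (\<lambda>u. scaled_variance v0 (max u m0))"
    by (rule continuous_on_compose2[OF continuous_on_scaled_variance]) (auto intro!: continuous_intros)
  note borel_measurable_continuous_onI[OF this, measurable]
  have [measurable]: "(\<lambda>u. scaled_variance v0 (max u m0)) \<in> borel_measurable borel" by measurable
  show ?thesis by measurable
qed

theorem theorem5p3:
  fixes lam p :: real
    and F F0 :: "real measure"
    and P :: "'a measure"
    and D X :: "nat \<Rightarrow> 'a \<Rightarrow> real"
  defines "\<mu> \<equiv> optimal_policy lam F F0"
    and "V \<equiv> (\<lambda>t. prob_space.variance P (sale_price (optimal_policy lam F F0) D X t))"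
  assumes lam_pos: "0 < lam"
    and F: "real_distribution F"
    and F0: "real_distribution F0"
    and int_X: "integrable F (\<lambda>x. max x 0)"
    and int_X0: "integrable F0 (\<lambda>x. \<bar>x\<bar>)"
    and mean_nonneg: "0 \<le> residual_mean F0"
    and mean_less: "ereal (residual_mean F0) < upper_end F"
    and unbounded: "upper_end F = \<infinity>"
    and int_phi: "\<And>x. set_integrable lborel {x..} (phi F)"
    and p_pos: "0 < p"
    and lim_phi: "((\<lambda>x. x * phi F x / (LBINT u:{x..}. phi F u)) \<longlongrightarrow> p) at_top"
  shows "regularly_varying \<mu> (1 / (p + 2)) \<and>
    (\<forall>c < 1 / (p + 2). filterlim (\<lambda>t. \<mu> t / t powr c) at_top at_top) \<and>
    (\<forall>c > 1 / (p + 2). ((\<lambda>t. \<mu> t / t powr c) \<longlongrightarrow> 0) at_top) \<and>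
    (integrable F0 (\<lambda>x. x\<^sup>2) \<and> bidding_model lam F F0 P D X \<longrightarrow>
      regularly_varying V (2 / (p + 2)) \<and>
      (\<forall>c < 2 / (p + 2). filterlim (\<lambda>t. V t / t powr c) at_top at_top) \<and>
      (\<forall>c > 2 / (p + 2). ((\<lambda>t. V t / t powr c) \<longlongrightarrow> 0) at_top))"
proof -
  interpret F: real_distribution F by fact
  interpret F0: real_distribution F0 by fact
  have cdf_less: "cdf F x < 1" for x
  proof -
    have "ereal x < (SUP x\<in>{x. cdf F x < 1}. ereal x)"
      using unbounded by (simp add: upper_end_def)
    then obtain y where "cdf F y < 1" "x < y" by (auto simp: less_SUP_iff)
    then show ?thesis using F.cdf_nondecreasing[of x y] by simp
  qed
  interpret optimal_selling F lam F0
    by unfold_locales (use int_X cdf_less int_phi lam_pos in auto)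
  note lim_e = lim_phi[folded Phi_def]
  note pos = eventually_\<mu>_pos[folded \<mu>_def]
  note ratio = \<mu>_ratio_tendsto[OF p_pos lim_e, folded \<mu>_def]
  note ln_ratio = ln_\<mu>_ratio_tendsto[OF p_pos lim_e, folded \<mu>_def]
  have V_part: "regularly_varying V (2 / (p + 2)) \<and>
      (\<forall>c < 2 / (p + 2). filterlim (\<lambda>t. V t / t powr c) at_top at_top) \<and>
      (\<forall>c > 2 / (p + 2). ((\<lambda>t. V t / t powr c) \<longlongrightarrow> 0) at_top)"
    if int2: "integrable F0 (\<lambda>x. x\<^sup>2)" and model: "bidding_model lam F F0 P D X"
  proof -
    interpret P: prob_space P using model by (simp add: bidding_model_def)
    have int1: "integrable F0 (\<lambda>x. x)"
      using int_X0 by (simp add: integrable_abs_iff)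
    define v0 where "v0 = (\<integral>x. x\<^sup>2 \<partial>F0) - m0\<^sup>2"
    have V_eq: "V t = phi F (\<mu> t) * scaled_variance v0 (\<mu> t)" if "0 \<le> t" for t
    proof -
      interpret sale_process F lam F0 P D X t
        by unfold_locales (use model that in \<open>simp_all add: bidding_model_def\<close>)
      show ?thesis
        unfolding V_def \<mu>_def by (rule variance_sale_price[OF F0 int1 int2 mean_nonneg v0_def])
    qed
    have V_nonneg: "0 \<le> V t" for t
      unfolding V_def by (rule P.variance_positive)
    have "(\<lambda>t. phi F (\<mu> (max t 0)) * scaled_variance v0 (max (\<mu> (max t 0)) m0)) \<in> borel_measurable (restrict_space borel {0..})"
      unfolding \<mu>_def by (intro measurable_restrict_space1 measurable_variance_formula)
    then have V_meas: "V \<in> borel_measurable (restrict_space borel {0..})"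
      by (rule measurable_cong[THEN iffD1, rotated])
         (auto simp: space_restrict_space V_eq max_absorb1 m0_le_\<mu> \<mu>_def)
    have V_lim: "((\<lambda>t. V t / (\<mu> t)\<^sup>2) \<longlongrightarrow> 2 / (p * (p + 3))) at_top"
      using variance_over_square_tendsto[OF p_pos lim_e, of v0, folded \<mu>_def]
    proof (rule Lim_transform_eventually)
      show "\<forall>\<^sub>F t in at_top. phi F (\<mu> t) * scaled_variance v0 (\<mu> t) / (\<mu> t)\<^sup>2 = V t / (\<mu> t)\<^sup>2"
        using eventually_ge_at_top[of 0] by eventually_elim (simp add: V_eq)
    qed
    have C_pos: "0 < 2 / (p * (p + 3))" using p_pos by simp
    show ?thesis
      using regularly_varying_if_asymptotic_to_square[OF V_meas V_nonneg pos ratio V_lim C_pos]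
        asymptotic_to_square_over_powr_at_top[OF pos ln_ratio V_lim C_pos]
        asymptotic_to_square_over_powr_tendsto_0[OF pos ln_ratio V_lim C_pos]
      by simp
  qed
  show ?thesis
    using regularly_varying_\<mu>[OF p_pos lim_e mean_nonneg, folded \<mu>_def]
      over_powr_at_top[OF pos ln_ratio] over_powr_tendsto_0[OF pos ln_ratio] V_part
    by blast
qed

end
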